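(* Let $m\ge0$ and $K\ge1$ be integers, let $\varepsilon\in\{1,-1\}$, and let $a,b,c\in\mathbb{C}$ with $c\notin\{0,-1,-2,\ldots\}$ and $j+1-a\ne0$, $j+1-b\neq0$ for $1\le j\le m$. If $\varepsilon=1$, assume also $\operatorname{Re}(c-a-b)>-1$; if $\varepsilon=-1$, assume that the series $A^{(K)}_{m,\varepsilon}(a,b,c)$ and $A^{(k)}_{0,\varepsilon}(a,b,c)$, $1\le k\le K$, converge. Then $$A_{m,\varepsilon}^{(K)}(a,b,c)=\sum_{s=0}^{K-1}(-1)^s r_{m,s}\,A_{0,\varepsilon}^{(K-s)}(a,b,c)+(-1)^{K-1}\sum_{j=1}^{m}\ \sum_{u,v\ge0,\, u+v=K-1}t_{m,j,u}\,e_{\varepsilon,j,v}(a,b,c).$$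
   Context: Notation: $(u)_0=1$, $(u)_n=u(u+1)\cdots(u+n-1)$. For integers $m\ge0$, $K\ge1$, $$A_{m,\varepsilon}^{(K)}(a,b,c)=\sum_{n=0}^{\infty}\frac{\varepsilon^n(a)_n(b)_n}{(c)_n n!}\frac{1}{(n+m+1)^K}.$$ The coefficients $r_{m,s}$, $t_{m,j,s}$ (which depend also on $a,b,c,\varepsilon$) and $e_{\varepsilon,j,v}$ are the Taylor coefficients at $\lambda=0$ in $$\mathcal R_m(\lambda)=\varepsilon^m\frac{(1+\lambda)_m(2-c+\lambda)_m}{(2-a+\lambda)_m(2-b+\lambda)_m}=\sum_{s\ge0}r_{m,s}\lambda^s,\qquad \mathcal R_0(\lambda)=1,$$ $$\mathcal T_{m,j}(\lambda)=\varepsilon^{m-j+1}\frac{(j+1+\lambda)_{m-j}(j+2-c+\lambda)_{m-j}}{(j+1-a+\lambda)_{m-j+1}(j+1-b+\lambda)_{m-j+1}}=\sum_{s\ge0}t_{m,j,s}\lambda^s\quad(1\le j\le m),$$ $$E_\varepsilon(j+\lambda;a,b,c)=\sum_{v\ge0}e_{\varepsilon,j,v}(a,b,c)\lambda^v.$$ Here, for $\varepsilon=1$, $E_+(M;a,b,c)=\frac{\Gamma(c)\Gamma(c-a-b+1)}{\Gamma(c-a)\Gamma(c-b)}$ (independent of $M$; $1/\Gamma(z)=0$ at non-positive integers $z$), and, for $\varepsilon=-1$, $$E_-(M;a,b,c)=(c+a+b-2M-2)\,{}_2F_1(a,b;c;-1)-2\left.\frac{d}{dz}{}_2F_1(a,b;c;z)\right|_{z=-1},$$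 where ${}_2F_1(a,b;c;z)$ is the Gauss hypergeometric function, continued analytically to $\mathbb{C}\setminus[1,\infty)$ (principal branch). *)

theory Defs
  imports "HOL-Complex_Analysis.Complex_Analysis"
begin

definition A_term :: "complex \<Rightarrow> nat \<Rightarrow> nat \<Rightarrow> complex \<Rightarrow> complex \<Rightarrow> complex \<Rightarrow> nat \<Rightarrow> complex" where
  "A_term \<epsilon> m K a b c n =
     \<epsilon> ^ n * pochhammer a n * pochhammer b n / (pochhammer c n * fact n)
       * (1 / of_nat (n + m + 1) ^ K)"

text \<open>The series need only converge conditionally when \<open>\<epsilon> = -1\<close>, so the sum is taken
  in the natural order of the index.\<close>

definition A_sum :: "complex \<Rightarrow> nat \<Rightarrow> nat \<Rightarrow> complex \<Rightarrow> complex \<Rightarrow> complex \<Rightarrow> complex" where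
  "A_sum \<epsilon> m K a b c = (\<Sum>n. A_term \<epsilon> m K a b c n)"

definition R_fun :: "complex \<Rightarrow> nat \<Rightarrow> complex \<Rightarrow> complex \<Rightarrow> complex \<Rightarrow> complex \<Rightarrow> complex" where
  "R_fun \<epsilon> m a b c x =
     \<epsilon> ^ m * (pochhammer (1 + x) m * pochhammer (2 - c + x) m)
       / (pochhammer (2 - a + x) m * pochhammer (2 - b + x) m)"

text \<open>Only meaningful for \<open>1 \<le> j \<le> m\<close>: the subtraction on the naturals is then exact.\<close>

definition T_fun ::
  "complex \<Rightarrow> nat \<Rightarrow> nat \<Rightarrow> complex \<Rightarrow> complex \<Rightarrow> complex \<Rightarrow> complex \<Rightarrow> complex" where
  "T_fun \<epsilon> m j a b c x =
     \<epsilon> ^ (m - j + 1)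
       * (pochhammer (of_nat j + 1 + x) (m - j) * pochhammer (of_nat j + 2 - c + x) (m - j))
       / (pochhammer (of_nat j + 1 - a + x) (m - j + 1)
          * pochhammer (of_nat j + 1 - b + x) (m - j + 1))"

text \<open>The principal branch of the Gauss function: the analytic continuation of the
  hypergeometric series from the unit disc to the plane slit along \<open>[1, \<infinity>)\<close>. By the identity
  theorem it is unique on that (connected) domain; values on the slit are unspecified.\<close>

definition hyp2F1 :: "complex \<Rightarrow> complex \<Rightarrow> complex \<Rightarrow> complex \<Rightarrow> complex" where
  "hyp2F1 a b c = (SOME F. F holomorphic_on (- complex_of_real ` {1..}) \<and>
     (\<forall>z\<in>ball 0 1. F z = eval_fps (fps_hypergeo [a, b] [c] 1) z))"

text \<open>\<^const>\<open>rGamma\<close> is the entire function \<open>1 / \<Gamma>\<close>, vanishing at the non-positive integers.\<close>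

definition E_plus :: "complex \<Rightarrow> complex \<Rightarrow> complex \<Rightarrow> complex \<Rightarrow> complex" where
  "E_plus M a b c = Gamma c * Gamma (c - a - b + 1) * rGamma (c - a) * rGamma (c - b)"

definition E_minus :: "complex \<Rightarrow> complex \<Rightarrow> complex \<Rightarrow> complex \<Rightarrow> complex" where
  "E_minus M a b c = (c + a + b - 2 * M - 2) * hyp2F1 a b c (-1) - 2 * deriv (hyp2F1 a b c) (-1)"

definition E_fun :: "complex \<Rightarrow> complex \<Rightarrow> complex \<Rightarrow> complex \<Rightarrow> complex \<Rightarrow> complex" where
  "E_fun \<epsilon> M a b c = (if \<epsilon> = 1 then E_plus M a b c else E_minus M a b c)"

definition r_coeff :: "complex \<Rightarrow> nat \<Rightarrow> complex \<Rightarrow> complex \<Rightarrow> complex \<Rightarrow> nat \<Rightarrow> complex" where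
  "r_coeff \<epsilon> m a b c s = fps_nth (fps_expansion (R_fun \<epsilon> m a b c) 0) s"

definition t_coeff :: "complex \<Rightarrow> nat \<Rightarrow> nat \<Rightarrow> complex \<Rightarrow> complex \<Rightarrow> complex \<Rightarrow> nat \<Rightarrow> complex" where
  "t_coeff \<epsilon> m j a b c s = fps_nth (fps_expansion (T_fun \<epsilon> m j a b c) 0) s"

definition e_coeff :: "complex \<Rightarrow> nat \<Rightarrow> complex \<Rightarrow> complex \<Rightarrow> complex \<Rightarrow> nat \<Rightarrow> complex" where
  "e_coeff \<epsilon> j a b c v = fps_nth (fps_expansion (\<lambda>x. E_fun \<epsilon> (of_nat j + x) a b c) 0) v"

end

theory Submission
  imports Defs "HOL-Real_Asymp.Real_Asymp"
begin

text \<open>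
  Write \<open>h\<^sub>n = \<epsilon>\<^sup>n (a)\<^sub>n (b)\<^sub>n / ((c)\<^sub>n n!)\<close>. All sums \<open>A\<^sub>j\<^sup>(\<^sup>K\<^sup>)\<close> with the same \<open>j\<close> are, up to sign, the Taylor
  coefficients in \<open>\<lambda>\<close> of the single series \<open>S\<^sub>j = \<Sum>\<^sub>n h\<^sub>n / (n + j + 1 + \<lambda>)\<close>. Decomposing
  \<open>(n + a)(n + b) / (n + j + 1 + \<lambda>)\<close> into partial fractions and using the two-term recurrence
  \<open>(n + 1)(n + c) h\<^sub>n\<^sub>+\<^sub>1 = \<epsilon> (n + a)(n + b) h\<^sub>n\<close> gives
  \<open>(j + 1 - a + \<lambda>)(j + 1 - b + \<lambda>) S\<^sub>j = \<epsilon> (j + \<lambda>)(j + 1 - c + \<lambda>) S\<^sub>j\<^sub>-\<^sub>1 + \<epsilon> E(j + \<lambda>)\<close>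
  with an inhomogeneity of degree at most one in \<open>\<lambda>\<close>. Solving this first-order recurrence in \<open>j\<close> produces the
  products \<open>R\<^sub>m\<close> and \<open>T\<^sub>m\<^sub>,\<^sub>j\<close>, and the coefficient of \<open>\<lambda>\<^sup>K\<^sup>-\<^sup>1\<close> is the claim.

  The series may converge only conditionally and the series behind \<open>E\<close> may diverge, so everything is
  done with Abel sums: \<open>h\<^sub>n\<close> is damped to \<open>h\<^sub>n x\<^sup>n\<close> with \<open>0 < x < 1\<close>, where the recurrence is an
  identity of formal power series in \<open>\<lambda>\<close> (\<open>moment_fps_recurrence\<close>), and then \<open>x\<close> tends to \<open>1\<close>. By
  Abel's theorem (\<open>Abel_limit\<close>) it is enough that the given series converge, and only finitely many
  coefficients in \<open>\<lambda>\<close> are ever involved, namely those below \<open>\<lambda>\<^sup>K\<close> (\<open>moment_fps_tendsto\<close>).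

  What remains is the limit of the inhomogeneity (\<open>boundary_fps_tendsto\<close>). For \<open>\<epsilon> = 1\<close> it is a
  telescoping combination whose sum is a \<open>\<^sub>2F\<^sub>1\<close> at \<open>1\<close> with \<open>c\<close> raised to \<open>c + 1\<close>; Gauss's summation
  theorem (\<open>Gauss_summation\<close>) evaluates it in the whole range \<open>Re (c - a - b) > -1\<close>. For
  \<open>\<epsilon> = -1\<close> it is a combination of the values at \<open>-x\<close> of the Gauss function and its derivative, and
  one needs that the continuation to the slit plane exists (\<open>hyp2F1_continuation_exists\<close>). To get it,
  compose the series with the map \<open>w \<mapsto> 4 w / (1 + w)\<^sup>2\<close> from the unit disc onto the slit plane: the
  hypergeometric equation becomes a recurrence for the Taylor coefficients in \<open>w\<close> whose solutions grow
  subexponentially, so the composed series converges on the whole disc.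
\<close>

section \<open>Abel summation\<close>

lemma tendsto_norm_bound:
  fixes X :: "nat \<Rightarrow> 'a :: real_normed_vector"
  assumes "X \<longlonglongrightarrow> L" obtains B where "\<And>n. norm (X n) \<le> B"
  using assms convergentI convergent_imp_Bseq BseqE by metis

text \<open>
  The weights \<open>(1 - x) x\<^sup>n\<close> have total mass \<open>1\<close> and move to infinity as \<open>x\<close> tends to \<open>1\<close>, so the weighted
  means of a convergent sequence tend to its limit.
\<close>
lemma Abel_means:
  fixes s :: "nat \<Rightarrow> complex"
  assumes s: "s \<longlonglongrightarrow> L"
  shows "((\<lambda>x. (1 - of_real x) * (\<Sum>n. s n * of_real x ^ n)) \<longlongrightarrow> L) (at_left (1::real))"
proof (rule tendstoI)
  fix e :: real assume e: "e > 0"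
  from s e obtain N where N: "\<And>n. n \<ge> N \<Longrightarrow> norm (s n - L) < e / 2"
    by (metis LIMSEQ_D half_gt_zero)
  obtain B where B: "\<And>n. norm (s n) \<le> B"
    using tendsto_norm_bound[OF s] by blast
  define C where "C = (\<Sum>n<N. norm (s n - L))"
  have "((\<lambda>x. (1 - x) * C) \<longlongrightarrow> (1 - 1) * C) (at_left (1::real))"
    by (intro tendsto_intros)
  then have "\<forall>\<^sub>F x in at_left 1. (1 - x) * C < e / 2"
    by (rule order_tendstoD(2)) (use e in auto)
  moreover have "\<forall>\<^sub>F x in at_left (1::real). x \<in> {0<..<1}"
    by (rule eventually_at_left_real) auto
  ultimately show "\<forall>\<^sub>F x in at_left 1. dist ((1 - of_real x) * (\<Sum>n. s n * of_real x ^ n)) L < e"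
  proof eventually_elim
    case (elim x)
    then have x: "0 < x" "x < 1" by auto
    have geo: "(\<lambda>n. of_real x ^ n :: complex) sums (1 / (1 - of_real x))"
      using x by (intro geometric_sums) auto
    have sm: "summable (\<lambda>n. s n * of_real x ^ n)"
    proof (rule summable_comparison_test')
      show "summable (\<lambda>n. B * x ^ n)" using x by (intro summable_mult summable_geometric) auto
      show "norm (s n * of_real x ^ n) \<le> B * x ^ n" for n
        using B[of n] x by (auto simp: norm_mult norm_power intro!: mult_right_mono)
    qed
    have gr: "(\<lambda>n. e / 2 * x ^ n) sums (e / 2 * (1 / (1 - x)))"
      using x by (intro sums_mult geometric_sums) auto
    have fin: "(\<lambda>n. if n \<in> {..<N} then norm (s n - L) else 0) sums C"
      unfolding C_def by (rule sums_If_finite_set) auto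
    have bd: "norm ((s n - L) * of_real x ^ n)
        \<le> (if n \<in> {..<N} then norm (s n - L) else 0) + e / 2 * x ^ n" for n
    proof (cases "n < N")
      case True
      have "norm (s n - L) * x ^ n \<le> norm (s n - L) * 1"
        using x by (intro mult_left_mono power_le_one) auto
      moreover have "e / 2 * x ^ n \<ge> 0" using e x by auto
      ultimately show ?thesis using True x by (simp add: norm_mult norm_power)
    next
      case False
      then show ?thesis using N[of n] x
        by (auto simp: norm_mult norm_power intro!: mult_right_mono)
    qed
    have sd: "(\<lambda>n. (s n - L) * of_real x ^ n) sums
        ((\<Sum>n. s n * of_real x ^ n) - L * (1 / (1 - of_real x)))"
      using sums_diff[OF summable_sums[OF sm] sums_mult[OF geo, of L]]
      by (simp add: algebra_simps)
    have "norm ((\<Sum>n. s n * of_real x ^ n) - L * (1 / (1 - of_real x))) \<le> C + e / 2 * (1 / (1 - x))"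
      unfolding sums_unique[OF sd] sums_unique[OF sums_add[OF fin gr]]
      by (rule norm_suminf_le[OF bd sums_summable[OF sums_add[OF fin gr]]])
    then have "(1 - x) * norm ((\<Sum>n. s n * of_real x ^ n) - L * (1 / (1 - of_real x)))
        \<le> (1 - x) * (C + e / 2 * (1 / (1 - x)))"
      using x by (intro mult_left_mono) auto
    also have "\<dots> = (1 - x) * C + e / 2" using x by (simp add: field_simps)
    also have "\<dots> < e" using elim by simp
    also have "(1 - x) * norm ((\<Sum>n. s n * of_real x ^ n) - L * (1 / (1 - of_real x)))
       = norm ((1 - of_real x) * ((\<Sum>n. s n * of_real x ^ n) - L * (1 / (1 - of_real x))))"
    proof -
      have "norm (1 - of_real x :: complex) = 1 - x"
        using x by (metis norm_of_real of_real_1 of_real_diff abs_of_pos diff_gt_0_iff_gt)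
      then show ?thesis by (simp add: norm_mult)
    qed
    also have "(1 - of_real x) * ((\<Sum>n. s n * of_real x ^ n) - L * (1 / (1 - of_real x))) =
       (1 - of_real x) * (\<Sum>n. s n * of_real x ^ n) - L"
      using x by (simp add: right_diff_distrib)
    finally show ?case by (simp add: dist_norm)
  qed
qed

text \<open>
  Summation by parts turns the power series into \<open>1 - x\<close> times the power series of the partial sums.
\<close>
theorem Abel_limit:
  fixes f :: "nat \<Rightarrow> complex"
  assumes f: "f sums S"
  shows "((\<lambda>x. \<Sum>n. f n * of_real x ^ n) \<longlongrightarrow> S) (at_left (1::real))"
proof -
  define s where "s n = (\<Sum>k\<le>n. f k)" for n
  have s: "s \<longlonglongrightarrow> S" using f unfolding sums_def_le s_def .
  obtain B where B: "\<And>n. norm (s n) \<le> B"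
    using tendsto_norm_bound[OF s] by blast
  have "\<forall>\<^sub>F x in at_left (1::real). x \<in> {0<..<1}"
    by (rule eventually_at_left_real) auto
  then have "\<forall>\<^sub>F x in at_left (1::real). (1 - of_real x) * (\<Sum>n. s n * of_real x ^ n)
      = (\<Sum>n. f n * of_real x ^ n)"
  proof eventually_elim
    case (elim x)
    then have x: "0 < x" "x < 1" by auto
    have sm: "summable (\<lambda>n. s n * of_real x ^ n)"
    proof (rule summable_comparison_test')
      show "summable (\<lambda>n. B * x ^ n)" using x by (intro summable_mult summable_geometric) auto
      show "norm (s n * of_real x ^ n) \<le> B * x ^ n" for n
        using B[of n] x by (auto simp: norm_mult norm_power intro!: mult_right_mono)
    qed
    define T where "T = (\<Sum>n. s n * of_real x ^ n)"
    have 1: "(\<lambda>n. s n * of_real x ^ n) sums T" unfolding T_def by (rule summable_sums[OF sm])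
    have "(\<lambda>n. of_real x * (s n * of_real x ^ n)) sums (of_real x * T)"
      by (rule sums_mult[OF 1])
    then have "(\<lambda>n. (if Suc n = 0 then 0 else s (Suc n - 1)) * of_real x ^ Suc n) sums (of_real x * T)"
      by (simp add: mult_ac)
    then have 2: "(\<lambda>n. (if n = 0 then 0 else s (n - 1)) * of_real x ^ n) sums (of_real x * T)"
      by (subst (asm) sums_Suc_iff) auto
    have fe: "s n - (if n = 0 then 0 else s (n - 1)) = f n" for n
      by (cases n) (auto simp: s_def)
    from sums_diff[OF 1 2] have "(\<lambda>n. f n * of_real x ^ n) sums (T - of_real x * T)"
      unfolding left_diff_distrib[symmetric] fe .
    then show ?case unfolding T_def[symmetric]
      by (simp add: sums_iff left_diff_distrib)
  qed
  then show ?thesis using Abel_means[OF s] by (rule Lim_transform_eventually[rotated])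
qed

section \<open>Coefficientwise convergence of series of formal power series\<close>

definition sums_coeffwise :: "(nat \<Rightarrow> complex fps) \<Rightarrow> complex fps \<Rightarrow> bool" where
  "sums_coeffwise f F \<longleftrightarrow> (\<forall>k. (\<lambda>n. fps_nth (f n) k) sums fps_nth F k)"

lemma sums_coeffwise_mult:
  assumes "sums_coeffwise f F" shows "sums_coeffwise (\<lambda>n. P * f n) (P * F)"
  using assms unfolding sums_coeffwise_def fps_mult_nth
  by (auto intro!: sums_sum sums_mult)

lemma sums_coeffwise_add:
  assumes "sums_coeffwise f F" "sums_coeffwise g G"
  shows "sums_coeffwise (\<lambda>n. f n + g n) (F + G)"
  using assms unfolding sums_coeffwise_def by (auto intro!: sums_add)

lemma sums_coeffwise_diff:
  assumes "sums_coeffwise f F" "sums_coeffwise g G"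
  shows "sums_coeffwise (\<lambda>n. f n - g n) (F - G)"
  using assms unfolding sums_coeffwise_def by (auto intro!: sums_diff)

lemma sums_coeffwise_const:
  assumes "f sums F" shows "sums_coeffwise (\<lambda>n. fps_const (f n)) (fps_const F)"
  using assms unfolding sums_coeffwise_def by auto

lemma sums_coeffwise_unique:
  assumes "sums_coeffwise f F" "sums_coeffwise f G" shows "F = G"
  using assms unfolding sums_coeffwise_def fps_eq_iff by (metis sums_unique2)

lemma sums_coeffwise_Suc:
  assumes "sums_coeffwise f F" "f 0 = 0" shows "sums_coeffwise (\<lambda>n. f (Suc n)) F"
  unfolding sums_coeffwise_def
proof
  fix k
  show "(\<lambda>n. fps_nth (f (Suc n)) k) sums fps_nth F k"
    using assms sums_Suc_iff[of "\<lambda>n. fps_nth (f n) k" "fps_nth F k"]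
    by (simp add: sums_coeffwise_def)
qed

section \<open>Growth of the hypergeometric coefficients\<close>

definition hyp_coeff :: "complex \<Rightarrow> complex \<Rightarrow> complex \<Rightarrow> nat \<Rightarrow> complex" where
  "hyp_coeff a b c n = pochhammer a n * pochhammer b n / (pochhammer c n * fact n)"

lemma hyp_coeff_0 [simp]: "hyp_coeff a b c 0 = 1"
  by (simp add: hyp_coeff_def)

lemma pochhammer_nonzero:
  assumes "(c::complex) \<notin> \<int>\<^sub>\<le>\<^sub>0" shows "pochhammer c n \<noteq> 0" "c + of_nat n \<noteq> 0" "of_nat n + c \<noteq> 0"
proof -
  show *: "c + of_nat n \<noteq> 0"
    using assms by (metis add_eq_0_iff2 minus_of_nat_in_nonpos_Ints)
  show "of_nat n + c \<noteq> 0" using * by (simp add: add.commute)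
  show "pochhammer c n \<noteq> 0"
    using assms by (metis minus_of_nat_in_nonpos_Ints pochhammer_eq_0_iff)
qed

lemma hyp_coeff_Suc:
  assumes "c \<notin> \<int>\<^sub>\<le>\<^sub>0"
  shows "hyp_coeff a b c (Suc n) * (of_nat n + 1) * (of_nat n + c)
    = hyp_coeff a b c n * (of_nat n + a) * (of_nat n + b)"
proof -
  have "pochhammer c n \<noteq> 0" "c + of_nat n \<noteq> 0" "(of_nat n + 1 :: complex) \<noteq> 0"
    using pochhammer_nonzero[OF assms] by (auto simp: add.commute[of _ 1] of_nat_Suc[symmetric] simp del: of_nat_Suc)
  then show ?thesis
    by (simp add: hyp_coeff_def pochhammer_Suc divide_simps add.commute mult_ac)
qed

text \<open>
  The quotient of the coefficient by \<open>n\<close> to the power \<open>a + b - c - 1\<close> is a quotient of the sequences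
  in Euler's product for \<open>1 / \<Gamma>\<close>, hence convergent. This also covers terminating series, where its
  limit is zero.
\<close>
lemma hyp_coeff_bound:
  assumes "c \<notin> \<int>\<^sub>\<le>\<^sub>0"
  obtains B where "\<And>n. n \<ge> 1 \<Longrightarrow>
    norm (hyp_coeff a b c (Suc n)) \<le> B * real n powr (Re (a + b - c) - 1)"
proof -
  define q where "q n = rGamma_series a n * rGamma_series b n / (rGamma_series c n * rGamma_series 1 n)" for n
  have "q \<longlonglongrightarrow> rGamma a * rGamma b / (rGamma c * rGamma 1)"
    unfolding q_def using assms by (intro tendsto_intros) (auto simp: rGamma_eq_zero_iff)
  then obtain B where B: "\<And>n. norm (q n) \<le> B"
    by (rule tendsto_norm_bound) blast
  show ?thesis
  proof (rule that[of B])
    fix n :: nat assume n: "n \<ge> 1"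
    have "hyp_coeff a b c (Suc n) = q n * exp ((a + b - c - 1) * of_real (ln (real n)))"
    proof -
      define E where "E z = exp (z * of_real (ln (real n)))" for z :: complex
      have E: "E z \<noteq> 0" for z by (simp add: E_def)
      have "exp ((a + b - c - 1) * of_real (ln (real n))) = E a * E b / (E c * E 1)"
        unfolding E_def by (simp add: exp_diff exp_add left_diff_distrib distrib_right)
      moreover have "q n = pochhammer a (Suc n) / (fact n * E a) * (pochhammer b (Suc n) / (fact n * E b)) /
          (pochhammer c (Suc n) / (fact n * E c) * (fact (Suc n) / (fact n * E 1)))"
        by (simp add: q_def rGamma_series_def E_def pochhammer_fact del: fact_Suc)
      moreover have "pa / (f * E a) * (pb / (f * E b)) / (pc / (f * E c) * (g / (f * E 1))) * (E a * E b / (E c * E 1))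
          = pa * pb / (pc * g)" if "f \<noteq> 0" for pa pb pc f g
        using that E[of a] E[of b] E[of c] E[of 1] by simp
      ultimately show ?thesis by (simp only: hyp_coeff_def fact_nonzero not_False_eq_True)
    qed
    then have "norm (hyp_coeff a b c (Suc n)) = norm (q n) * norm (exp ((a + b - c - 1) * of_real (ln (real n))))"
      by (simp add: norm_mult)
    also have "norm (exp ((a + b - c - 1) * of_real (ln (real n)))) = real n powr (Re (a + b - c) - 1)"
      using n by (simp add: powr_def)
    also have "norm (q n) * \<dots> \<le> B * \<dots>" by (intro mult_right_mono B) auto
    finally show "norm (hyp_coeff a b c (Suc n)) \<le> B * real n powr (Re (a + b - c) - 1)" .
  qed
qed

lemma conv_radius_hyp_coeff:
  assumes "c \<notin> \<int>\<^sub>\<le>\<^sub>0" shows "conv_radius (hyp_coeff a b c) \<ge> 1"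
proof -
  obtain B where B: "\<And>n. n \<ge> 1 \<Longrightarrow>
    norm (hyp_coeff a b c (Suc n)) \<le> B * real n powr (Re (a + b - c) - 1)"
    by (rule hyp_coeff_bound[OF assms, of a b]) blast
  define p where "p = Re (a + b - c) - 1"
  have "conv_radius (\<lambda>n. hyp_coeff a b c (n + 1)) \<ge> 1"
  proof (rule conv_radius_geI_ex')
    fix r :: real assume r: "0 < r" "ereal r < 1"
    then have r1: "r < 1" by (metis ereal_less(3))
    define s where "s = (r + 1) / 2"
    have s: "0 < s" "s < 1" "r < s" using r r1 by (auto simp: s_def)
    \<comment> \<open>Geometric decay with any ratio above \<open>r\<close> absorbs the polynomial factor.\<close>
    define d where "d = - ln s"
    have d: "d > 0" using s by (simp add: d_def)
    have "s ^ n = exp (- d * real n)" for n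
      using s by (simp add: d_def exp_of_nat2_mult)
    moreover have "(\<lambda>n. real n powr p * exp (- d * real n)) \<longlonglongrightarrow> 0"
      using d by real_asymp
    ultimately have "(\<lambda>n. real n powr p * s ^ n) \<longlonglongrightarrow> 0" by (simp only:)
    then obtain C where C: "\<And>n. norm (real n powr p * s ^ n) \<le> C"
      by (rule tendsto_norm_bound) blast
    have "summable (\<lambda>n. norm (real n powr p) * r ^ n)"
      by (rule Abel_lemma[of _ s _ C]) (use r s C in \<open>auto simp: abs_mult\<close>)
    then have sm: "summable (\<lambda>n. B * (real n powr p * r ^ n))"
      by (intro summable_mult) simp
    show "summable (\<lambda>n. hyp_coeff a b c (n + 1) * of_real r ^ n)"
    proof (rule summable_comparison_test'[OF sm, of 1])
      fix n :: nat assume n: "1 \<le> n"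
      show "norm (hyp_coeff a b c (n + 1) * of_real r ^ n) \<le> B * (real n powr p * r ^ n)"
        using B[OF n] r unfolding p_def[symmetric]
        by (auto simp: norm_mult norm_power mult.assoc[symmetric] intro!: mult_right_mono)
    qed
  qed
  then show ?thesis by (simp only: conv_radius_shift)
qed

lemma hyp_coeff_decay:
  assumes "c \<notin> \<int>\<^sub>\<le>\<^sub>0" "Re (c - a - b) > 0"
  shows "summable (\<lambda>n. norm (hyp_coeff a b c n))" "(\<lambda>n. of_nat n * hyp_coeff a b c n) \<longlonglongrightarrow> 0"
proof -
  obtain B where B: "\<And>n. n \<ge> 1 \<Longrightarrow>
    norm (hyp_coeff a b c (Suc n)) \<le> B * real n powr (Re (a + b - c) - 1)"
    by (rule hyp_coeff_bound[OF assms(1), of a b]) blast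
  define p where "p = Re (a + b - c)"
  have p: "p < 0" using assms(2) by (simp add: p_def)
  have "summable (\<lambda>n. B * real n powr (p - 1))"
    using p by (intro summable_mult) (simp add: summable_real_powr_iff)
  then have "summable (\<lambda>n. norm (hyp_coeff a b c (Suc n)))"
    by (rule summable_comparison_test'[of _ 1]) (use B in \<open>auto simp: p_def\<close>)
  then show "summable (\<lambda>n. norm (hyp_coeff a b c n))" by (subst (asm) summable_Suc_iff)
  have "(\<lambda>n. of_nat (Suc n) * hyp_coeff a b c (Suc n)) \<longlonglongrightarrow> 0"
  proof (rule Lim_null_comparison)
    show "\<forall>\<^sub>F n in sequentially. norm (of_nat (Suc n) * hyp_coeff a b c (Suc n))
        \<le> real (Suc n) * (B * real n powr (p - 1))"
      using eventually_ge_at_top[of 1]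
    proof eventually_elim
      case (elim n)
      show ?case using B[OF elim] unfolding norm_mult norm_of_nat p_def
        by (intro mult_left_mono) auto
    qed
    show "(\<lambda>n. real (Suc n) * (B * real n powr (p - 1))) \<longlonglongrightarrow> 0"
      using p by real_asymp
  qed
  then show "(\<lambda>n. of_nat n * hyp_coeff a b c n) \<longlonglongrightarrow> 0"
    by (rule LIMSEQ_imp_Suc)
qed

section \<open>Gauss's summation theorem\<close>

lemma hyp_coeff_shift_c:
  assumes "c \<notin> \<int>\<^sub>\<le>\<^sub>0"
  shows "hyp_coeff a b c n / (of_nat n + c) = hyp_coeff a b (c + 1) n / c"
proof -
  have "pochhammer c n * (of_nat n + c) = c * pochhammer (c + 1) n"
    using pochhammer_rec[of c n] pochhammer_Suc[of c n] by (simp add: add.commute)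
  then show ?thesis
    using pochhammer_nonzero[OF assms] by (simp add: hyp_coeff_def field_simps)
qed

text \<open>
  The key to both Gauss's theorem and the case \<open>\<epsilon> = 1\<close>: the difference of \<open>n h\<^sub>n\<close> compensates
  \<open>(c - a - b) h\<^sub>n\<close> up to the terms of the series with \<open>c + 1\<close>, which decay faster by one power of \<open>n\<close>.
  It rests on \<open>(n + a)(n + b) = (c - a)(c - b) + (n + c)(n + a + b - c)\<close>.
\<close>
lemma hyp_coeff_telescope:
  assumes "c \<notin> \<int>\<^sub>\<le>\<^sub>0"
  shows "of_nat (Suc n) * hyp_coeff a b c (Suc n) - of_nat n * hyp_coeff a b c n
     + (c - a - b) * hyp_coeff a b c n = (c - a) * (c - b) / c * hyp_coeff a b (c + 1) n"
proof -
  note nz = pochhammer_nonzero(3)[OF assms, of n]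
  have "of_nat (Suc n) * hyp_coeff a b c (Suc n) =
     hyp_coeff a b c n * (of_nat n + a) * (of_nat n + b) / (of_nat n + c)"
    using hyp_coeff_Suc[OF assms, of a b n] nz by (simp add: field_simps)
  also have "\<dots> = hyp_coeff a b c n / (of_nat n + c) * ((of_nat n + a) * (of_nat n + b))" by simp
  also have "(of_nat n + a) * (of_nat n + b) =
     (c - a) * (c - b) + (of_nat n + c) * (of_nat n - (c - a - b))"
    by (simp add: algebra_simps)
  also have "hyp_coeff a b c n / (of_nat n + c) * \<dots> = hyp_coeff a b c n / (of_nat n + c) * ((c - a) * (c - b))
      + hyp_coeff a b c n * (of_nat n - (c - a - b))"
    using nz by (simp add: distrib_left)
  also have "hyp_coeff a b c n / (of_nat n + c) = hyp_coeff a b (c + 1) n / c"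
    by (rule hyp_coeff_shift_c[OF assms])
  finally have "of_nat (Suc n) * hyp_coeff a b c (Suc n) =
      hyp_coeff a b (c + 1) n / c * ((c - a) * (c - b)) + hyp_coeff a b c n * (of_nat n - (c - a - b))" .
  moreover have "x = y / c * (p * q) + z * (m - d) \<Longrightarrow> x - m * z + d * z = p * q / c * y" for x y z p q m d
    by (simp add: algebra_simps)
  ultimately show ?thesis by blast
qed

lemma nonpos_Ints_add_nat:
  assumes "(c::complex) \<notin> \<int>\<^sub>\<le>\<^sub>0" shows "c + of_nat n \<notin> \<int>\<^sub>\<le>\<^sub>0"
  using assms nonpos_Ints_diff_Nats[of "c + of_nat n" "of_nat n"] by auto

lemma hyp_sum_shift_c:
  assumes c: "c \<notin> \<int>\<^sub>\<le>\<^sub>0" and r: "Re (c - a - b) > 0"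
  shows "(c - a - b) * c * (\<Sum>n. hyp_coeff a b c n)
     = (c - a) * (c - b) * (\<Sum>n. hyp_coeff a b (c + 1) n)"
proof -
  have c1: "c + 1 \<notin> \<int>\<^sub>\<le>\<^sub>0" using nonpos_Ints_add_nat[OF c, of 1] by simp
  have c0: "c \<noteq> 0" using c by auto
  have r1: "Re (c + 1 - a - b) > 0" using r by simp
  have "(\<lambda>n. of_nat (Suc n) * hyp_coeff a b c (Suc n) - of_nat n * hyp_coeff a b c n) sums (0 - of_nat 0 * hyp_coeff a b c 0)"
    using telescope_sums[OF hyp_coeff_decay(2)[OF c r]] by simp
  from sums_add[OF this sums_mult[OF summable_sums[OF summable_norm_cancel[OF hyp_coeff_decay(1)[OF c r]]], of "c - a - b"]]
  have "(\<lambda>n. (c - a) * (c - b) / c * hyp_coeff a b (c + 1) n) sums ((c - a - b) * (\<Sum>n. hyp_coeff a b c n))"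
    unfolding hyp_coeff_telescope[OF c] by simp
  moreover have "(\<lambda>n. (c - a) * (c - b) / c * hyp_coeff a b (c + 1) n) sums
      ((c - a) * (c - b) / c * (\<Sum>n. hyp_coeff a b (c + 1) n))"
    by (intro sums_mult summable_sums summable_norm_cancel[OF hyp_coeff_decay(1)[OF c1 r1]])
  ultimately have "(c - a - b) * (\<Sum>n. hyp_coeff a b c n) = (c - a) * (c - b) / c * (\<Sum>n. hyp_coeff a b (c + 1) n)"
    by (rule sums_unique2)
  then show ?thesis using c0 by (simp add: field_simps)
qed

lemma hyp_sum_shift_c_iterate:
  assumes c: "c \<notin> \<int>\<^sub>\<le>\<^sub>0" and r: "Re (c - a - b) > 0"
  shows "pochhammer (c - a - b) n * pochhammer c n * (\<Sum>k. hyp_coeff a b c k)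
     = pochhammer (c - a) n * pochhammer (c - b) n * (\<Sum>k. hyp_coeff a b (c + of_nat n) k)"
proof (induction n)
  case (Suc n)
  have "Re (c + of_nat n - a - b) > 0" using r by simp
  from hyp_sum_shift_c[OF nonpos_Ints_add_nat[OF c] this]
  have *: "(c - a - b + of_nat n) * (c + of_nat n) * (\<Sum>k. hyp_coeff a b (c + of_nat n) k)
     = (c - a + of_nat n) * (c - b + of_nat n) * (\<Sum>k. hyp_coeff a b (c + of_nat (Suc n)) k)"
    by (simp add: algebra_simps)
  have "pochhammer (c - a - b) (Suc n) * pochhammer c (Suc n) * (\<Sum>k. hyp_coeff a b c k)
    = (c - a - b + of_nat n) * (c + of_nat n) * (pochhammer (c - a - b) n * pochhammer c n * (\<Sum>k. hyp_coeff a b c k))"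
    by (simp add: pochhammer_Suc mult_ac)
  also have "\<dots> = pochhammer (c - a) n * pochhammer (c - b) n *
     ((c - a - b + of_nat n) * (c + of_nat n) * (\<Sum>k. hyp_coeff a b (c + of_nat n) k))"
    unfolding Suc.IH by (simp add: mult_ac)
  finally show ?case unfolding * by (simp add: pochhammer_Suc mult_ac)
qed auto

lemma norm_pochhammer_le: "norm (pochhammer (a::complex) n) \<le> pochhammer (norm a) n"
  unfolding pochhammer_prod prod_norm[symmetric]
  by (auto intro!: prod_mono order_trans[OF norm_triangle_ineq])

lemma norm_pochhammer_ge:
  assumes "0 \<le> x" "x \<le> Re c" shows "pochhammer x n \<le> norm (pochhammer (c::complex) n)"
proof -
  have "x + real i \<le> norm (c + of_nat i)" for i
    using complex_Re_le_cmod[of "c + of_nat i"] assms by simp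
  then show ?thesis
    using assms unfolding pochhammer_prod by (auto simp: prod_norm[symmetric] intro!: prod_mono)
qed

text \<open>
  Every term but the first vanishes in the limit, and the terms are eventually dominated by those of a
  convergent series with positive real parameters, so Tannery's theorem applies.
\<close>
lemma hyp_sum_tendsto_1:
  "(\<lambda>n. \<Sum>k. hyp_coeff a b (c + of_nat n) k) \<longlonglongrightarrow> 1"
proof -
  \<comment> \<open>Chosen so that the dominating series has positive excess \<open>x - norm a - norm b\<close>.\<close>
  define x where "x = norm a + norm b + 1"
  have x: "x > 0" unfolding x_def by (intro add_nonneg_pos add_nonneg_nonneg) auto
  define M where "M k = norm (hyp_coeff (of_real (norm a)) (of_real (norm b)) (of_real x) k)" for k
  have "(of_real x :: complex) \<notin> \<int>\<^sub>\<le>\<^sub>0"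
    using x by (auto simp: of_real_in_nonpos_Ints_iff elim!: nonpos_Ints_cases)
  then have sM: "summable M" unfolding M_def by (intro hyp_coeff_decay(1)) (auto simp: x_def)
  have lim: "(\<lambda>n. hyp_coeff a b (c + of_nat n) k) \<longlonglongrightarrow> (if k = 0 then 1 else 0)" for k
  proof (cases "k = 0")
    case False
    have "(\<lambda>n. inverse (c + of_nat n + of_nat i)) \<longlonglongrightarrow> 0" for i
      by (intro filterlim_compose[OF tendsto_inverse_0]
          tendsto_add_filterlim_at_infinity[OF tendsto_const]
          tendsto_add_filterlim_at_infinity'[OF _ tendsto_const] tendsto_of_nat)
    then have "(\<lambda>n. pochhammer a k * pochhammer b k / fact k * (\<Prod>i=0..<k. inverse (c + of_nat n + of_nat i)))
       \<longlonglongrightarrow> pochhammer a k * pochhammer b k / fact k * (\<Prod>i=0..<k. 0)"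
      by (intro tendsto_mult tendsto_const tendsto_prod)
    then show ?thesis using False
      by (simp add: hyp_coeff_def pochhammer_prod prod_inversef[unfolded comp_def] divide_inverse power_0_left mult_ac)
  qed auto
  have bd: "norm (hyp_coeff a b (c + of_nat n) k) \<le> M k" if n: "x \<le> Re c + real n" for n k
  proof -
    have px: "pochhammer x k > 0" using x by (rule pochhammer_pos)
    have nn: "pochhammer (norm a) k \<ge> 0" "pochhammer (norm b) k \<ge> 0"
      by (auto simp: pochhammer_prod intro!: prod_nonneg)
    have "norm (hyp_coeff a b (c + of_nat n) k) =
      norm (pochhammer a k) * norm (pochhammer b k) / (norm (pochhammer (c + of_nat n) k) * fact k)"
      by (simp add: hyp_coeff_def norm_mult norm_divide)
    also have "\<dots> \<le> pochhammer (norm a) k * pochhammer (norm b) k / (pochhammer x k * fact k)"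
      using px n x nn by (intro frac_le mult_mono norm_pochhammer_le norm_pochhammer_ge) auto
    also have "\<dots> = M k"
      using px nn unfolding M_def hyp_coeff_def
      by (simp add: pochhammer_of_real norm_mult norm_divide)
    finally show ?thesis .
  qed
  have "(\<lambda>n. \<Sum>k. hyp_coeff a b (c + of_nat n) k) \<longlonglongrightarrow> (\<Sum>k. if k = 0 then 1 else 0)"
  proof (rule tannerys_theorem[THEN conjunct2, THEN conjunct2])
    show "\<And>k. (\<lambda>n. hyp_coeff a b (c + of_nat n) k) \<longlonglongrightarrow> (if k = 0 then 1 else 0)" by (rule lim)
    have "\<forall>\<^sub>F n in sequentially. x \<le> Re c + real n"
      by real_asymp
    then show "\<forall>\<^sub>F (k, n) in sequentially \<times>\<^sub>F sequentially. norm (hyp_coeff a b (c + of_nat n) k) \<le> M k"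
      unfolding eventually_prod_filter
      by (intro exI[of _ "\<lambda>_. True"] exI[of _ "\<lambda>n. x \<le> Re c + real n"]) (auto intro: bd)
  qed (use sM in auto)
  also have "(\<Sum>k::nat. if k = 0 then 1 else 0 :: complex) = 1"
    using suminf_finite[of "{0}" "\<lambda>k. if k = 0 then 1 else 0 :: complex"] by auto
  finally show ?thesis .
qed

text \<open>
  Raising \<open>c\<close> to \<open>c + n\<close> multiplies the sum by Pochhammer symbols that approximate the four Gamma
  factors, while the raised sum itself tends to \<open>1\<close>. The exponential factors of the approximations
  cancel because \<open>(c - a - b) + c = (c - a) + (c - b)\<close>.
\<close>
theorem Gauss_summation:
  assumes c: "c \<notin> \<int>\<^sub>\<le>\<^sub>0" and r: "Re (c - a - b) > 0"
  shows "hyp_coeff a b c sums (Gamma c * Gamma (c - a - b) * rGamma (c - a) * rGamma (c - b))"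
proof -
  let ?F = "\<Sum>k. hyp_coeff a b c k"
  have eq: "rGamma_series (c - a - b) n * rGamma_series c n * ?F =
     rGamma_series (c - a) n * rGamma_series (c - b) n * (\<Sum>k. hyp_coeff a b (c + of_nat (Suc n)) k)" for n
  proof -
    define E where "E z = exp (z * of_real (ln (real n)))" for z :: complex
    have EE: "E (c - a - b) * E c = E (c - a) * E (c - b)"
      unfolding E_def exp_add[symmetric] by (simp add: algebra_simps)
    have R: "rGamma_series z n = pochhammer z (Suc n) / (fact n * E z)" for z
      by (simp add: rGamma_series_def E_def)
    have "rGamma_series (c - a - b) n * rGamma_series c n * ?F =
      (pochhammer (c - a - b) (Suc n) * pochhammer c (Suc n) * ?F) / (fact n * fact n * (E (c - a - b) * E c))"
      unfolding R by (simp add: mult_ac)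
    also have "\<dots> = (pochhammer (c - a) (Suc n) * pochhammer (c - b) (Suc n) *
      (\<Sum>k. hyp_coeff a b (c + of_nat (Suc n)) k)) / (fact n * fact n * (E (c - a) * E (c - b)))"
      unfolding hyp_sum_shift_c_iterate[OF c r, of "Suc n"] EE ..
    also have "\<dots> = rGamma_series (c - a) n * rGamma_series (c - b) n * (\<Sum>k. hyp_coeff a b (c + of_nat (Suc n)) k)"
      unfolding R by (simp add: mult_ac)
    finally show ?thesis .
  qed
  have "(\<lambda>n. rGamma_series (c - a - b) n * rGamma_series c n * ?F) \<longlonglongrightarrow>
      rGamma (c - a - b) * rGamma c * ?F"
    by (intro tendsto_intros)
  moreover have "(\<lambda>n. rGamma_series (c - a - b) n * rGamma_series c n * ?F) \<longlonglongrightarrow>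
      rGamma (c - a) * rGamma (c - b) * 1"
    unfolding eq by (intro tendsto_intros LIMSEQ_Suc[OF hyp_sum_tendsto_1])
  ultimately have "rGamma (c - a - b) * rGamma c * ?F = rGamma (c - a) * rGamma (c - b) * 1"
    by (rule LIMSEQ_unique)
  moreover have "rGamma c \<noteq> 0" using c by (simp add: rGamma_eq_zero_iff)
  moreover have "rGamma (c - a - b) \<noteq> 0"
  proof
    assume "rGamma (c - a - b) = 0"
    then obtain n where "c - a - b = of_int n" "n \<le> 0"
      by (auto simp: rGamma_eq_zero_iff elim: nonpos_Ints_cases)
    with r show False by (metis Re_complex_of_real of_int_le_0_iff of_real_of_int_eq not_le)
  qed
  ultimately have "?F = Gamma c * Gamma (c - a - b) * rGamma (c - a) * rGamma (c - b)"
    by (simp add: Gamma_def field_simps)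
  then show ?thesis
    using summable_sums[OF summable_norm_cancel[OF hyp_coeff_decay(1)[OF c r]]] by simp
qed

section \<open>Analytic continuation of the Gauss function to the slit plane\<close>

text \<open>
  For large \<open>n\<close> the recurrences express each new pair through earlier ones with total weight
  \<open>1 + O(1 / n)\<close>, which is less than \<open>1 / \<rho>\<close> from some index on; a bound \<open>B / \<rho>\<^sup>n\<close> that holds up to that
  index therefore persists. The sequence \<open>v\<close> has to be treated first, since the new \<open>u\<close> depends on the
  new \<open>v\<close>.
\<close>
lemma two_step_recurrence_growth:
  fixes u v :: "nat \<Rightarrow> complex"
  assumes u: "\<And>n. of_nat (Suc n) * u (Suc n) + of_nat n * u n = v (Suc n) - v n"
    and v: "\<And>n. of_nat (Suc (Suc n)) * v (Suc (Suc n)) - of_nat n * v n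
       = p * (v (Suc (Suc n)) + 2 * v (Suc n) + v n) + q * v (Suc n) + r * u (Suc n)"
    and \<rho>: "0 < \<rho>" "\<rho> < 1"
  shows "\<exists>B. \<forall>n. norm (u n) * \<rho> ^ n \<le> B"
proof -
  define C where "C = 3 * norm p + norm q + norm r"
  have "\<forall>\<^sub>F n in sequentially. (real n + C) * \<rho> \<le> real n + 2 - norm p"
    using \<rho> by real_asymp
  moreover have "\<forall>\<^sub>F n in sequentially. 1 \<le> (1 - \<rho>) * (real n + 2)"
    using \<rho> by real_asymp
  moreover have "\<forall>\<^sub>F n in sequentially. 0 < real n + 2 - norm p"
    by real_asymp
  ultimately have "\<forall>\<^sub>F n in sequentially. (real n + C) * \<rho> \<le> real n + 2 - norm p
     \<and> 1 \<le> (1 - \<rho>) * (real n + 2) \<and> 0 < real n + 2 - norm p"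
    by eventually_elim auto
  then obtain N where N: "\<And>n. n \<ge> N \<Longrightarrow> (real n + C) * \<rho> \<le> real n + 2 - norm p"
      "\<And>n. n \<ge> N \<Longrightarrow> 1 \<le> (1 - \<rho>) * (real n + 2)" "\<And>n. n \<ge> N \<Longrightarrow> 0 < real n + 2 - norm p"
    unfolding eventually_at_top_linorder by blast
  define B where "B = (\<Sum>k\<le>Suc N. norm (u k) + norm (v k))"
  have B0: "B \<ge> 0" unfolding B_def by (intro sum_nonneg) auto
  have "norm (u n) \<le> B / \<rho> ^ n \<and> norm (v n) \<le> B / \<rho> ^ n" for n
  proof (induction n rule: less_induct)
    case (less n)
    show ?case
    proof (cases "n \<le> Suc N")
      case True
      then have "norm (u n) + norm (v n) \<le> B"
        unfolding B_def by (intro member_le_sum) auto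
      moreover have "B \<le> B / \<rho> ^ n"
        using \<rho> B0 power_le_one[of \<rho> n] by (simp add: field_simps mult_left_le)
      ultimately show ?thesis
        using norm_ge_zero[of "u n"] norm_ge_zero[of "v n"] by linarith
    next
      case False
      then obtain m where m: "n = Suc (Suc m)" "m \<ge> N"
        by (metis Suc_le_D Suc_le_mono not_less_eq_eq)
      define T where "T = B / \<rho> ^ Suc m"
      have T0: "T \<ge> 0" using B0 \<rho> by (simp add: T_def)
      have Tn: "B / \<rho> ^ n = T / \<rho>" by (simp add: T_def m)
      have "B / \<rho> ^ m \<le> T"
        using \<rho> B0 unfolding T_def by (intro divide_left_mono) (auto simp: mult_left_le_one_le)
      then have b: "norm (v m) \<le> T" "norm (v (Suc m)) \<le> T" "norm (u (Suc m)) \<le> T"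
        using less[of m] less[of "Suc m"] m by (auto simp: T_def)
      have "(of_nat (Suc (Suc m)) - p) * v n = (of_nat m + p) * v m + (2 * p + q) * v (Suc m) + r * u (Suc m)"
        using v[of m] m by (simp add: algebra_simps)
      then have "norm ((of_nat (Suc (Suc m)) - p) * v n) =
          norm ((of_nat m + p) * v m + (2 * p + q) * v (Suc m) + r * u (Suc m))" by simp
      also have "\<dots> \<le> norm (of_nat m + p) * norm (v m) + norm (2 * p + q) * norm (v (Suc m)) + norm r * norm (u (Suc m))"
        by (intro norm_triangle_le add_mono) (auto simp: norm_mult)
      also have "\<dots> \<le> norm (of_nat m + p) * T + norm (2 * p + q) * T + norm r * T"
        by (intro add_mono mult_left_mono b) auto
      also have "\<dots> = (norm (of_nat m + p) + norm (2 * p + q) + norm r) * T"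
        by (simp add: algebra_simps)
      also have "\<dots> \<le> (real m + C) * T"
      proof (rule mult_right_mono[OF _ T0])
        have "norm (of_nat m + p) \<le> real m + norm p" using norm_triangle_ineq[of "of_nat m" p] by simp
        moreover have "norm (2 * p + q) \<le> 2 * norm p + norm q"
          using norm_triangle_ineq[of "2 * p" q] by (simp add: norm_mult)
        ultimately show "norm (of_nat m + p) + norm (2 * p + q) + norm r \<le> real m + C"
          by (simp add: C_def)
      qed
      finally have 1: "norm (of_nat (Suc (Suc m)) - p) * norm (v n) \<le> (real m + C) * T"
        by (simp add: norm_mult)
      have "real m + 2 - norm p \<le> norm (of_nat (Suc (Suc m)) - p)"
        using norm_triangle_ineq2[of "of_nat (Suc (Suc m))" p] unfolding norm_of_nat by simp
      then have "(real m + 2 - norm p) * norm (v n) \<le> norm (of_nat (Suc (Suc m)) - p) * norm (v n)"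
        by (rule mult_right_mono) auto
      also note 1
      also have "(real m + C) * T = (real m + C) * \<rho> * (T / \<rho>)" using \<rho> by simp
      also have "\<dots> \<le> (real m + 2 - norm p) * (T / \<rho>)"
        using N(1)[OF m(2)] T0 \<rho> by (intro mult_right_mono) auto
      finally have v': "norm (v n) \<le> T / \<rho>"
        using N(3)[OF m(2)] by (simp only: mult_le_cancel_left_pos)
      have "of_nat n * u n = - (of_nat (Suc m) * u (Suc m)) + v n + - v (Suc m)"
        using u[of "Suc m"] m by (simp add: algebra_simps)
      then have "real n * norm (u n) = norm (- (of_nat (Suc m) * u (Suc m)) + v n + - v (Suc m))"
        by (metis norm_mult norm_of_nat)
      also have "\<dots> \<le> norm (of_nat (Suc m) * u (Suc m)) + norm (v n) + norm (v (Suc m))"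
        by (intro norm_triangle_le add_mono) (auto simp: norm_minus_cancel)
      also have "\<dots> \<le> real (Suc m) * T + T / \<rho> + T"
        unfolding norm_mult norm_of_nat by (intro add_mono mult_left_mono b v') auto
      also have "\<dots> = ((real m + 2) * \<rho> + 1) * (T / \<rho>)"
        using \<rho> by (simp add: field_simps)
      also have "\<dots> \<le> real n * (T / \<rho>)"
        using N(2)[OF m(2)] T0 \<rho> m by (intro mult_right_mono) (auto simp: algebra_simps)
      finally have "norm (u n) \<le> T / \<rho>" using m by (simp only: mult_le_cancel_left_pos of_nat_0_less_iff zero_less_Suc)
      with v' show ?thesis unfolding Tn by blast
    qed
  qed
  then have "norm (u n) * \<rho> ^ n \<le> B" for n using \<rho> by (simp add: pos_le_divide_eq)
  then show ?thesis by blast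
qed

text \<open>
  The expansion of \<open>4 w / (1 + w)\<^sup>2\<close>, a rotated and scaled Koebe function: it maps the unit disc
  conformally onto the complement of \<open>[1, \<infinity>)\<close>.
\<close>
definition koebe_fps :: "complex fps" where
  "koebe_fps = 4 * fps_X * inverse ((1 + fps_X) ^ 2)"

lemma koebe_fps_mult: "(1 + fps_X) ^ 2 * koebe_fps = 4 * fps_X"
proof -
  have "(1 + fps_X) ^ 2 * inverse ((1 + fps_X) ^ 2 :: complex fps) = 1"
    by (intro inverse_mult_eq_1') (simp add: fps_power_zeroth)
  then show ?thesis unfolding koebe_fps_def by (metis mult.left_commute mult.right_neutral)
qed

lemma koebe_fps_nth_0 [simp]: "fps_nth koebe_fps 0 = 0"
  by (simp add: koebe_fps_def fps_mult_nth_0)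

lemma koebe_fps_deriv: "(1 + fps_X) * (fps_X * fps_deriv koebe_fps) = (1 - fps_X) * koebe_fps"
proof -
  have nz: "(1 + fps_X :: complex fps) ^ 2 \<noteq> 0" "(1 + fps_X :: complex fps) \<noteq> 0"
    by (auto simp: fps_eq_iff intro!: exI[of _ 0])
  have "fps_deriv ((1 + fps_X) ^ 2 * koebe_fps) = 4"
    unfolding koebe_fps_mult by simp
  then have d: "(1 + fps_X) ^ 2 * fps_deriv koebe_fps + 2 * (1 + fps_X) * koebe_fps = 4"
    by (simp add: power2_eq_square algebra_simps)
  have "(1 + fps_X) ^ 2 * ((1 + fps_X) * (fps_X * fps_deriv koebe_fps)) =
      (1 + fps_X) * fps_X * ((1 + fps_X) ^ 2 * fps_deriv koebe_fps)" by (simp add: mult_ac)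
  also have "(1 + fps_X) ^ 2 * fps_deriv koebe_fps = 4 - 2 * (1 + fps_X) * koebe_fps"
    using d by (simp add: algebra_simps)
  also have "(1 + fps_X) * fps_X * (4 - 2 * (1 + fps_X) * koebe_fps) =
      (1 + fps_X) * (4 * fps_X) - 2 * fps_X * ((1 + fps_X) ^ 2 * koebe_fps)"
    by (simp add: power2_eq_square algebra_simps)
  also have "\<dots> = (1 - fps_X) * (4 * fps_X)" unfolding koebe_fps_mult by (simp add: algebra_simps)
  also have "\<dots> = (1 + fps_X) ^ 2 * ((1 - fps_X) * koebe_fps)"
    unfolding koebe_fps_mult[symmetric] by (simp add: mult_ac)
  finally show ?thesis using nz by (simp only: mult_cancel_left) simp
qed

text \<open>
  Under the substitution the Euler operator \<open>z d/dz\<close> becomes \<open>(1 + w) / (1 - w)\<close> times \<open>w d/dw\<close>, here with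
  denominators cleared.
\<close>
lemma koebe_chain_rule:
  "(1 + fps_X) * (fps_X * fps_deriv (G oo koebe_fps)) = (1 - fps_X) * ((fps_X * fps_deriv G) oo koebe_fps)"
proof -
  have "(1 + fps_X) * (fps_X * fps_deriv (G oo koebe_fps)) =
     (1 + fps_X) * (fps_X * fps_deriv koebe_fps) * (fps_deriv G oo koebe_fps)"
    by (simp add: fps_compose_deriv mult_ac)
  also have "\<dots> = (1 - fps_X) * (koebe_fps * (fps_deriv G oo koebe_fps))"
    unfolding koebe_fps_deriv by (simp add: mult_ac)
  also have "koebe_fps * (fps_deriv G oo koebe_fps) = (fps_X * fps_deriv G) oo koebe_fps"
    by (simp add: fps_compose_mult_distrib)
  finally show ?thesis .
qed

text \<open>
  The hypergeometric equation, written with the Euler operator \<open>\<theta> = z d/dz\<close> and \<open>V = \<theta> F\<close> as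
  \<open>\<theta> V + (c - 1) V = z (\<theta> V + (a + b) V + a b F)\<close>.
\<close>
lemma fps_hypergeo_ode:
  fixes a b c :: complex
  assumes c: "c \<notin> \<int>\<^sub>\<le>\<^sub>0"
  defines "F \<equiv> Abs_fps (hyp_coeff a b c)"
  defines "V \<equiv> fps_X * fps_deriv F"
  shows "fps_X * fps_deriv V + fps_const (c - 1) * V =
    fps_X * (fps_X * fps_deriv V + fps_const (a + b) * V + fps_const (a * b) * F)"
proof (rule fps_ext)
  fix n
  have V: "fps_nth V n = of_nat n * hyp_coeff a b c n" for n
    by (cases n) (auto simp: V_def F_def)
  have V': "fps_nth (fps_X * fps_deriv V) n = of_nat n * fps_nth V n" for n
    by (cases n) auto
  show "fps_nth (fps_X * fps_deriv V + fps_const (c - 1) * V) n =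
    fps_nth (fps_X * (fps_X * fps_deriv V + fps_const (a + b) * V + fps_const (a * b) * F)) n"
  proof (cases n)
    case (Suc k)
    have "fps_nth (fps_X * fps_deriv V + fps_const (c - 1) * V) n =
       of_nat n * (of_nat n * hyp_coeff a b c n) + (c - 1) * (of_nat n * hyp_coeff a b c n)"
      unfolding fps_add_nth V' fps_mult_left_const_nth V ..
    also have "\<dots> = hyp_coeff a b c (Suc k) * (of_nat k + 1) * (of_nat k + c)"
      by (simp add: Suc algebra_simps)
    also have "\<dots> = hyp_coeff a b c k * (of_nat k + a) * (of_nat k + b)"
      by (rule hyp_coeff_Suc[OF c])
    also have "\<dots> = of_nat k * (of_nat k * hyp_coeff a b c k) + (a + b) * (of_nat k * hyp_coeff a b c k)
        + a * b * hyp_coeff a b c k" by (simp add: algebra_simps)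
    also have "\<dots> = fps_nth (fps_X * fps_deriv V + fps_const (a + b) * V + fps_const (a * b) * F) k"
      unfolding fps_add_nth V' fps_mult_left_const_nth V by (simp add: F_def)
    also have "\<dots> = fps_nth (fps_X * (fps_X * fps_deriv V + fps_const (a + b) * V + fps_const (a * b) * F)) n"
      by (simp add: Suc del: fps_mult_fps_X_deriv_shift)
    finally show ?thesis .
  qed (simp add: V)
qed

text \<open>
  The substituted equation is singular only at \<open>w = 0\<close> and \<open>w = \<plusminus> 1\<close>, which suggests that the solution
  regular at the origin has radius of convergence \<open>1\<close>. After clearing denominators, the first-order
  system for \<open>U = F \<circ> k\<close> and \<open>V = (\<theta> F) \<circ> k\<close>, where \<open>k\<close> is the Koebe map, has polynomial coefficients and
  turns into the recurrences of the growth lemma.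
\<close>
lemma conv_radius_hyp_koebe:
  assumes c: "c \<notin> \<int>\<^sub>\<le>\<^sub>0"
  shows "fps_conv_radius (Abs_fps (hyp_coeff a b c) oo koebe_fps) \<ge> 1"
proof -
  define F where "F = Abs_fps (hyp_coeff a b c)"
  define V0 where "V0 = fps_X * fps_deriv F"
  define U V W where "U = F oo koebe_fps" and "V = V0 oo koebe_fps"
    and "W = (fps_X * fps_deriv V0) oo koebe_fps"
  have eqU: "(1 + fps_X) * (fps_X * fps_deriv U) = (1 - fps_X) * V"
    unfolding U_def V_def V0_def by (rule koebe_chain_rule)
  have eqV: "(1 + fps_X) * (fps_X * fps_deriv V) = (1 - fps_X) * W"
    unfolding V_def W_def by (rule koebe_chain_rule)
  have "(fps_X * fps_deriv V0 + fps_const (c - 1) * V0) oo koebe_fps =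
    (fps_X * (fps_X * fps_deriv V0 + fps_const (a + b) * V0 + fps_const (a * b) * F)) oo koebe_fps"
    using fps_hypergeo_ode[OF c, of a b] unfolding V0_def F_def by simp
  then have W: "W + fps_const (c - 1) * V = koebe_fps * (W + fps_const (a + b) * V + fps_const (a * b) * U)"
    by (simp add: fps_compose_add_distrib fps_compose_mult_distrib[of koebe_fps] U_def V_def W_def)
  have "(1 + fps_X) ^ 2 * (W + fps_const (c - 1) * V) =
      4 * fps_X * (W + fps_const (a + b) * V + fps_const (a * b) * U)"
    unfolding W by (simp only: mult.assoc[symmetric] koebe_fps_mult)
  then have "(1 - fps_X) * ((1 - fps_X) * W) = - ((1 + fps_X) ^ 2 * fps_const (c - 1) * V)
      + 4 * fps_X * (fps_const (a + b) * V + fps_const (a * b) * U)"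
    by (simp add: power2_eq_square algebra_simps)
  then have "(1 - fps_X) * ((1 + fps_X) * (fps_X * fps_deriv V)) = - ((1 + fps_X) ^ 2 * fps_const (c - 1) * V)
      + 4 * fps_X * (fps_const (a + b) * V + fps_const (a * b) * U)"
    unfolding eqV .
  also have "- ((1 + fps_X) ^ 2 * fps_const (c - 1) * V) = (1 + fps_X) ^ 2 * (fps_const (1 - c) * V)"
    by (simp add: fps_const_neg[symmetric] algebra_simps flip: fps_const_sub)
  finally have eqV2: "(fps_X * fps_deriv V) - fps_X * (fps_X * (fps_X * fps_deriv V)) =
      fps_const (1 - c) * V + fps_X * (fps_const (2 * (1 - c)) * V) + fps_X * (fps_X * (fps_const (1 - c) * V))
     + fps_X * (fps_const (4 * (a + b)) * V + fps_const (4 * (a * b)) * U)"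
    by (simp add: power2_eq_square algebra_simps numeral_fps_const flip: fps_const_mult fps_const_sub fps_const_add)
  have th: "fps_nth (fps_X * fps_deriv G) n = of_nat n * fps_nth G n" for n and G :: "complex fps"
    by (cases n) auto
  have X: "fps_nth (fps_X * G) (Suc n) = fps_nth G n" for n and G :: "complex fps" by simp
  have u: "of_nat (Suc n) * fps_nth U (Suc n) + of_nat n * fps_nth U n = fps_nth V (Suc n) - fps_nth V n" for n
  proof -
    have "(fps_X * fps_deriv U) + fps_X * (fps_X * fps_deriv U) = V - fps_X * V"
      using eqU by (simp add: algebra_simps)
    from arg_cong[OF this, of "\<lambda>G. fps_nth G (Suc n)"] show ?thesis
      unfolding fps_add_nth fps_sub_nth X th fps_deriv_nth by simp
  qed
  have v: "of_nat (Suc (Suc n)) * fps_nth V (Suc (Suc n)) - of_nat n * fps_nth V n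
       = (1 - c) * (fps_nth V (Suc (Suc n)) + 2 * fps_nth V (Suc n) + fps_nth V n)
         + 4 * (a + b) * fps_nth V (Suc n) + 4 * (a * b) * fps_nth U (Suc n)" for n
  proof -
    from arg_cong[OF eqV2, of "\<lambda>G. fps_nth G (Suc (Suc n))"] show ?thesis
      unfolding fps_add_nth fps_sub_nth X th fps_mult_left_const_nth by (simp add: algebra_simps)
  qed
  show ?thesis unfolding F_def[symmetric] U_def[symmetric] fps_conv_radius_def
  proof (rule conv_radius_geI_ex')
    fix r :: real assume r: "0 < r" "ereal r < 1"
    then have r1: "r < 1" by (metis ereal_less(3))
    define s where "s = (r + 1) / 2"
    have s: "0 < s" "s < 1" "r < s" using r r1 by (auto simp: s_def)
    obtain B where B: "\<And>n. norm (fps_nth U n) * s ^ n \<le> B"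
      using two_step_recurrence_growth[OF u v s(1,2)] by blast
    have "summable (\<lambda>n. norm (fps_nth U n) * r ^ n)"
      by (rule Abel_lemma[of _ s _ B]) (use r s B in auto)
    then show "summable (\<lambda>n. fps_nth U n * of_real r ^ n)"
      using r by (intro summable_norm_cancel[of "\<lambda>n. fps_nth U n * of_real r ^ n"]) (simp add: norm_mult norm_power)
  qed
qed

lemma fps_hypergeo_2_1: "fps_hypergeo [a, b] [c] 1 = Abs_fps (hyp_coeff a b c)"
  by (rule fps_ext) (simp add: hyp_coeff_def)

lemma open_slit_plane: "open (- complex_of_real ` {1..})"
proof -
  have "complex_of_real ` {1..} = {z. Im z = 0} \<inter> {z. Re z \<ge> 1}"
    by (auto simp: complex_eq_iff image_iff)
  then show ?thesis
    by (simp only:) (intro open_Compl closed_Int closed_halfspace_Im_eq closed_halfspace_Re_ge)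
qed

text \<open>
  The inverse of the Koebe map on the slit plane is \<open>w = (1 - s) / (1 + s)\<close> with \<open>s\<close> the principal root of
  \<open>1 - z\<close>; there \<open>Re s > 0\<close>, so \<open>w\<close> lies in the unit disc. Evaluating the composed series at \<open>w\<close>
  gives a holomorphic function that agrees with the hypergeometric series near \<open>0\<close>, hence on the
  unit disc by the identity theorem.
\<close>
lemma hyp2F1_continuation_exists:
  assumes c: "c \<notin> \<int>\<^sub>\<le>\<^sub>0"
  shows "\<exists>F. F holomorphic_on (- complex_of_real ` {1..}) \<and>
     (\<forall>z\<in>ball 0 1. F z = eval_fps (fps_hypergeo [a, b] [c] 1) z)"
proof -
  define F where "F = Abs_fps (hyp_coeff a b c)"
  define U where "U = F oo koebe_fps"
  define D where "D = - complex_of_real ` {1..}"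
  define k where "k w = 4 * w / (1 + w) ^ 2" for w :: complex
  define s where "s z = csqrt (1 - z)" for z
  define w where "w z = (1 - s z) / (1 + s z)" for z
  have RF: "fps_conv_radius F \<ge> 1"
    using conv_radius_hyp_coeff[OF c] by (simp add: F_def fps_conv_radius_def)
  have RU: "fps_conv_radius U \<ge> 1"
    unfolding U_def F_def by (rule conv_radius_hyp_koebe[OF c])
  have slit: "1 - z \<notin> \<real>\<^sub>\<le>\<^sub>0" if "z \<in> D" for z
  proof
    assume "1 - z \<in> \<real>\<^sub>\<le>\<^sub>0"
    then obtain x where "1 - z = of_real x" "x \<le> 0" by (auto elim: nonpos_Reals_cases)
    then have "z = of_real (1 - x)" "1 - x \<in> {1..}" by (auto simp: algebra_simps)
    with that show False unfolding D_def by blast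
  qed
  have Re_s: "Re (s z) > 0" if "z \<in> D" for z
  proof -
    have "Re (s z) \<ge> 0" using csqrt_principal[of "1 - z"] by (auto simp: s_def)
    moreover have "Re (s z) \<noteq> 0"
    proof
      assume "Re (s z) = 0"
      then have "(s z) ^ 2 = of_real (- ((Im (s z)) ^ 2))"
        by (simp add: complex_eq_iff power2_eq_square)
      then have "1 - z = of_real (- ((Im (s z)) ^ 2))" by (simp add: s_def)
      then have "1 - z \<in> \<real>\<^sub>\<le>\<^sub>0" by (simp only: nonpos_Reals_of_real_iff) simp
      with slit[OF that] show False by blast
    qed
    ultimately show ?thesis by linarith
  qed
  have s1: "1 + s z \<noteq> 0" if "z \<in> D" for z
  proof
    assume "1 + s z = 0"
    then have "Re (1 + s z) = 0" by (simp only: zero_complex.sel)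
    with Re_s[OF that] show False by simp
  qed
  have norm_w: "norm (w z) < 1" if "z \<in> D" for z
  proof -
    have "(norm (1 - s z)) ^ 2 < (norm (1 + s z)) ^ 2"
      unfolding cmod_power2 using Re_s[OF that] by (simp add: power2_eq_square algebra_simps)
    then have "norm (1 - s z) < norm (1 + s z)" by (rule power2_less_imp_less) auto
    then show ?thesis using s1[OF that] by (simp add: w_def norm_divide)
  qed
  have kw: "k (w z) = z" if "z \<in> D" for z
  proof -
    have "1 + w z = 2 / (1 + s z)" using s1[OF that] by (simp add: w_def field_simps)
    then have "k (w z) = 4 * ((1 - s z) / (1 + s z)) / (2 / (1 + s z)) ^ 2"
      by (simp only: k_def) (simp only: w_def)
    also have "\<dots> = (1 - s z) * (1 + s z)"
    proof -
      have "4 * (q / p) / (2 / p) ^ 2 = q * p" if "p \<noteq> 0" for p q :: complex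
        using that by (simp add: power2_eq_square)
      then show ?thesis using s1[OF that] by blast
    qed
    also have "\<dots> = 1 - (s z) ^ 2" by (simp add: power2_eq_square algebra_simps)
    also have "\<dots> = z" by (simp add: s_def)
    finally show ?thesis .
  qed
  have hol_w: "w holomorphic_on D"
    unfolding w_def s_def using slit s1 by (intro holomorphic_intros) (auto simp: s_def)
  have hol: "(\<lambda>z. eval_fps U (w z)) holomorphic_on D"
    using norm_w RU
    by (intro holomorphic_on_compose_gen[OF hol_w, of "eval_fps U" "ball 0 1", unfolded o_def] holomorphic_on_eval_fps)
       (auto simp: eball_def intro: less_le_trans[of _ 1])
  have ball: "ball 0 1 \<subseteq> D"
    unfolding D_def by auto
  have openD: "open D" unfolding D_def by (rule open_slit_plane)
  have expk: "k has_fps_expansion koebe_fps"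
  proof -
    have "(\<lambda>w. 4 * w * inverse ((1 + w) ^ 2)) has_fps_expansion koebe_fps"
      unfolding koebe_fps_def by (intro fps_expansion_intros) (auto simp: fps_power_zeroth)
    then show ?thesis by (simp add: k_def[abs_def] divide_inverse)
  qed
  have "eval_fps F has_fps_expansion F"
    using RF by (intro eval_fps_has_fps_expansion) (auto intro: less_le_trans[of _ 1])
  from has_fps_expansion_compose[OF this expk]
  have "(eval_fps F \<circ> k) has_fps_expansion U" by (simp add: U_def)
  then have ev: "\<forall>\<^sub>F w in nhds 0. eval_fps U w = eval_fps F (k w)"
    by (simp add: has_fps_expansion_def)
  have "isCont w 0"
    using hol_w openD ball by (metis centre_in_ball continuous_on_eq_continuous_at holomorphic_on_imp_continuous_on subsetD zero_less_one)
  moreover have "w 0 = 0" by (simp add: w_def s_def)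
  ultimately have "filterlim w (nhds 0) (nhds 0)" by (simp add: continuous_within isCont_def tendsto_nhds_iff)
  from eventually_compose_filterlim[OF ev this]
  have "\<forall>\<^sub>F z in nhds 0. eval_fps U (w z) = eval_fps F (k (w z))" .
  moreover have "\<forall>\<^sub>F z in nhds 0. z \<in> ball 0 1" by (intro eventually_nhds_in_open) auto
  ultimately have "\<forall>\<^sub>F z in nhds 0. z \<in> ball 0 1 \<and> eval_fps U (w z) = eval_fps F z"
    by eventually_elim (use kw ball in auto)
  then obtain S where S: "open S" "0 \<in> S" "\<And>z. z \<in> S \<Longrightarrow> z \<in> ball 0 1 \<and> eval_fps U (w z) = eval_fps F z"
    unfolding eventually_nhds by blast
  have "eval_fps U (w z) = eval_fps F z" if "z \<in> ball 0 1" for z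
  proof (rule analytic_continuation_open[of S "ball 0 1" "\<lambda>z. eval_fps U (w z)" "eval_fps F"])
    show "(\<lambda>z. eval_fps U (w z)) holomorphic_on ball 0 1" by (rule holomorphic_on_subset[OF hol ball])
    show "eval_fps F holomorphic_on ball 0 1"
      using RF by (intro holomorphic_on_eval_fps) (auto simp: eball_def intro: less_le_trans[of _ 1])
  qed (use S that in auto)
  then show ?thesis
    unfolding fps_hypergeo_2_1 F_def[symmetric] D_def[symmetric] using hol by blast
qed

theorem hyp2F1_properties:
  assumes c: "c \<notin> \<int>\<^sub>\<le>\<^sub>0"
  shows hyp2F1_holomorphic: "hyp2F1 a b c holomorphic_on (- complex_of_real ` {1..})"
    and hyp2F1_sums: "norm z < 1 \<Longrightarrow> (\<lambda>n. hyp_coeff a b c n * z ^ n) sums hyp2F1 a b c z"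
proof -
  have *: "hyp2F1 a b c holomorphic_on (- complex_of_real ` {1..}) \<and>
     (\<forall>z\<in>ball 0 1. hyp2F1 a b c z = eval_fps (fps_hypergeo [a, b] [c] 1) z)"
    unfolding hyp2F1_def by (rule someI_ex[OF hyp2F1_continuation_exists[OF c]])
  then show "hyp2F1 a b c holomorphic_on (- complex_of_real ` {1..})" by blast
  assume z: "norm z < 1"
  then have "ereal (norm z) < fps_conv_radius (Abs_fps (hyp_coeff a b c))"
    using conv_radius_hyp_coeff[OF c, of a b] by (auto simp: fps_conv_radius_def intro: less_le_trans[of _ 1])
  from sums_eval_fps[OF this] show "(\<lambda>n. hyp_coeff a b c n * z ^ n) sums hyp2F1 a b c z"
    using * z by (simp add: fps_hypergeo_2_1)
qed

section \<open>The recurrence for the damped generating series\<close>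

lemma A_term_eq:
  "A_term \<epsilon> m K a b c n = \<epsilon> ^ n * hyp_coeff a b c n / of_nat (n + m + 1) ^ K"
  by (simp add: A_term_def hyp_coeff_def)

lemma pochhammer_has_fps_expansion:
  "(\<lambda>x. pochhammer (\<alpha> + x) n) has_fps_expansion pochhammer (fps_const (\<alpha>::complex) + fps_X) n"
proof -
  have "(\<lambda>x. of_nat i) has_fps_expansion (of_nat i :: complex fps)" for i
    using has_fps_expansion_const[of "of_nat i :: complex"] by (simp only: fps_of_nat)
  then show ?thesis
    unfolding pochhammer_prod by (intro fps_expansion_intros)
qed

lemma fps_pochhammer_nth_0:
  "fps_nth (pochhammer (fps_const (\<alpha>::complex) + fps_X) n) 0 = pochhammer \<alpha> n"
  using has_fps_expansion_imp_0_eq_fps_nth_0[OF pochhammer_has_fps_expansion[of \<alpha> n]] by simp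

lemma inverse_shift_fps_nth:
  assumes "z \<noteq> (0::complex)"
  shows "fps_nth (inverse (fps_const z + fps_X)) k = (-1) ^ k / z ^ Suc k"
proof -
  have "(fps_const z + fps_X) * Abs_fps (\<lambda>k. (-1) ^ k / z ^ Suc k) = 1"
  proof (rule fps_ext)
    fix k show "fps_nth ((fps_const z + fps_X) * Abs_fps (\<lambda>k. (-1) ^ k / z ^ Suc k)) k = fps_nth 1 k"
      using assms by (cases k) (auto simp: distrib_right field_simps)
  qed
  then have "inverse (fps_const z + fps_X) = Abs_fps (\<lambda>k. (-1) ^ k / z ^ Suc k)"
    by (rule fps_inverse_unique)
  then show ?thesis by simp
qed

lemma inverse_shift_fps:
  assumes "z \<noteq> (0::complex)"
  shows "(fps_const z + fps_X) * inverse (fps_const z + fps_X) = 1"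
  using assms by (intro inverse_mult_eq_1') auto

text \<open>
  The expansion in \<open>\<lambda>\<close> of the damped sum \<open>\<Sum>\<^sub>n h\<^sub>n x\<^sup>n / (n + j + 1 + \<lambda>)\<close>. In integral form this is the
  moment of order \<open>j + \<lambda>\<close> of \<open>t \<mapsto> F(\<epsilon> x t)\<close> on \<open>[0, 1]\<close>.
\<close>
definition moment_fps :: "complex \<Rightarrow> complex \<Rightarrow> complex \<Rightarrow> complex \<Rightarrow> nat \<Rightarrow> real \<Rightarrow> complex fps" where
  "moment_fps \<epsilon> a b c j x = Abs_fps (\<lambda>k. (-1) ^ k * (\<Sum>n. A_term \<epsilon> j (Suc k) a b c n * of_real x ^ n))"

lemma hyp_coeff_power_sums:
  assumes c: "c \<notin> \<int>\<^sub>\<le>\<^sub>0" and e: "norm \<epsilon> = 1" and x: "0 < x" "x < 1"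
  shows "summable (\<lambda>n. norm (\<epsilon> ^ n * hyp_coeff a b c n * of_real x ^ n))"
    and "summable (\<lambda>n. norm (of_nat n * (\<epsilon> ^ n * hyp_coeff a b c n * of_real x ^ n)))"
proof -
  let ?F = "Abs_fps (hyp_coeff a b c)"
  have r: "ereal (norm (of_real x :: complex)) < fps_conv_radius ?F"
    using conv_radius_hyp_coeff[OF c, of a b] x by (auto simp: fps_conv_radius_def intro: less_le_trans[of _ 1])
  show "summable (\<lambda>n. norm (\<epsilon> ^ n * hyp_coeff a b c n * of_real x ^ n))"
    using norm_summable_fps[OF r] e by (simp add: norm_mult norm_power)
  have "ereal (norm (of_real x :: complex)) < fps_conv_radius (fps_X * fps_deriv ?F)"
    using r fps_conv_radius_deriv[of ?F] fps_conv_radius_mult[of fps_X "fps_deriv ?F"]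
    by (simp add: less_le_trans)
  from norm_summable_fps[OF this]
  show "summable (\<lambda>n. norm (of_nat n * (\<epsilon> ^ n * hyp_coeff a b c n * of_real x ^ n)))"
  proof -
    have th: "fps_nth (fps_X * fps_deriv ?F) n = of_nat n * hyp_coeff a b c n" for n
      by (cases n) auto
    from \<open>summable (\<lambda>n. norm (fps_nth (fps_X * fps_deriv ?F) n * of_real x ^ n))\<close>
    show ?thesis unfolding th using e by (simp add: norm_mult norm_power mult_ac)
  qed
qed

lemma moment_fps_sums:
  assumes c: "c \<notin> \<int>\<^sub>\<le>\<^sub>0" and e: "norm \<epsilon> = 1" and x: "0 < x" "x < 1"
  shows "sums_coeffwise (\<lambda>n. fps_const (\<epsilon> ^ n * hyp_coeff a b c n * of_real x ^ n)
       * inverse (fps_const (of_nat (n + j + 1)) + fps_X)) (moment_fps \<epsilon> a b c j x)"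
  unfolding sums_coeffwise_def
proof
  fix k
  have "summable (\<lambda>n. A_term \<epsilon> j (Suc k) a b c n * of_real x ^ n)"
  proof (rule summable_comparison_test')
    show "summable (\<lambda>n. norm (\<epsilon> ^ n * hyp_coeff a b c n * of_real x ^ n))"
      by (rule hyp_coeff_power_sums[OF assms])
    show "norm (A_term \<epsilon> j (Suc k) a b c n * of_real x ^ n) \<le> norm (\<epsilon> ^ n * hyp_coeff a b c n * of_real x ^ n)" for n
    proof -
      have "A_term \<epsilon> j (Suc k) a b c n * of_real x ^ n =
          \<epsilon> ^ n * hyp_coeff a b c n * of_real x ^ n / of_nat ((n + j + 1) ^ Suc k)"
        unfolding A_term_eq of_nat_power by (simp only: times_divide_eq_left)
      moreover have "norm (z / of_nat ((n + j + 1) ^ Suc k)) \<le> norm z" for z :: complex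
      proof -
        have "1 \<le> (n + j + 1) ^ Suc k" by (rule one_le_power) simp
        then have "1 \<le> real ((n + j + 1) ^ Suc k)" by (metis of_nat_1 of_nat_le_iff)
        then have "norm z * 1 \<le> norm z * real ((n + j + 1) ^ Suc k)"
          by (rule mult_left_mono) simp
        then show ?thesis unfolding norm_divide norm_of_nat by (simp add: divide_le_eq del: power_Suc)
      qed
      ultimately show ?thesis by (simp only:)
    qed
  qed
  then have "(\<lambda>n. (-1) ^ k * (A_term \<epsilon> j (Suc k) a b c n * of_real x ^ n)) sums fps_nth (moment_fps \<epsilon> a b c j x) k"
    unfolding moment_fps_def fps_nth_Abs_fps by (intro sums_mult summable_sums)
  moreover have "fps_nth (fps_const (\<epsilon> ^ n * hyp_coeff a b c n * of_real x ^ n)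
       * inverse (fps_const (of_nat (n + j + 1)) + fps_X)) k = (-1) ^ k * (A_term \<epsilon> j (Suc k) a b c n * of_real x ^ n)" for n
    unfolding fps_mult_left_const_nth
    by (subst inverse_shift_fps_nth) (auto simp: A_term_eq simp del: of_nat_add of_nat_Suc)
  ultimately show "(\<lambda>n. fps_nth (fps_const (\<epsilon> ^ n * hyp_coeff a b c n * of_real x ^ n)
       * inverse (fps_const (of_nat (n + j + 1)) + fps_X)) k) sums fps_nth (moment_fps \<epsilon> a b c j x) k"
    by (simp only:)
qed

text \<open>
  \<open>\<theta>\<^sup>p F\<close> at \<open>\<epsilon> x\<close>, where \<open>F\<close> is the hypergeometric series and \<open>\<theta> = z d/dz\<close>.
\<close>
definition theta_sum :: "complex \<Rightarrow> complex \<Rightarrow> complex \<Rightarrow> complex \<Rightarrow> nat \<Rightarrow> real \<Rightarrow> complex" where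
  "theta_sum \<epsilon> a b c p x = (\<Sum>n. of_nat n ^ p * (\<epsilon> ^ n * hyp_coeff a b c n * of_real x ^ n))"

text \<open>
  The polynomial parts left over by the two partial fraction decompositions in the recurrence. They are
  \<open>\<epsilon> / x\<close> times the sum of \<open>h\<^sub>n x\<^sup>n (n + c - 1 - j - \<lambda>)\<close>, minus the sum of
  \<open>h\<^sub>n x\<^sup>n (n + a + b - j - 1 - \<lambda>)\<close>.
\<close>
definition boundary_fps :: "complex \<Rightarrow> complex \<Rightarrow> complex \<Rightarrow> complex \<Rightarrow> nat \<Rightarrow> real \<Rightarrow> complex fps" where
  "boundary_fps \<epsilon> a b c j x =
     fps_const (\<epsilon> / of_real x) * (fps_const (theta_sum \<epsilon> a b c 1 x + (c - 1 - of_nat j) * theta_sum \<epsilon> a b c 0 x)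
         - fps_X * fps_const (theta_sum \<epsilon> a b c 0 x))
     - (fps_const (theta_sum \<epsilon> a b c 1 x + (a + b - of_nat j - 1) * theta_sum \<epsilon> a b c 0 x)
         - fps_X * fps_const (theta_sum \<epsilon> a b c 0 x))"

text \<open>
  Polynomial division of \<open>(p - u)(p - v)\<close> by \<open>p\<close>. It is used with \<open>p = n + j + 1 + \<lambda>\<close>, where \<open>p - u = n + a\<close>
  and \<open>p - v = n + b\<close>, and with \<open>p = n + j + \<lambda>\<close>, where \<open>p - u = n\<close> and \<open>p - v = n + c - 1\<close>.
\<close>
lemma partial_fraction_step:
  fixes p q u v :: "'a::comm_ring_1"
  assumes "p * q = 1"
  shows "u * v * q = (p - u) * (p - v) * q - (p - u - v)"
proof -
  have "(p - u) * (p - v) * q = p * (p * q) - (u + v) * (p * q) + u * v * q"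
    by (simp add: algebra_simps)
  then show ?thesis unfolding assms by (simp add: algebra_simps)
qed

text \<open>
  Both partial fraction decompositions are summed against \<open>h\<^sub>n x\<^sup>n\<close>. The pole parts match after a shift of
  \<open>n\<close> by one, by the two-term recurrence of the coefficients; the factor \<open>1 / x\<close> comes from this shift.
\<close>
lemma moment_fps_recurrence:
  fixes a b c \<epsilon> :: complex
  assumes c: "c \<notin> \<int>\<^sub>\<le>\<^sub>0" and e: "\<epsilon> * \<epsilon> = 1" and x: "0 < x" "x < 1" and j: "j \<ge> 1"
  shows "(fps_const (of_nat j + 1 - a) + fps_X) * (fps_const (of_nat j + 1 - b) + fps_X) * moment_fps \<epsilon> a b c j x =
     fps_const (\<epsilon> / of_real x) * ((fps_const (of_nat j) + fps_X) * (fps_const (of_nat j + 1 - c) + fps_X)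
        * moment_fps \<epsilon> a b c (j - 1) x) + boundary_fps \<epsilon> a b c j x"
proof -
  have ne: "norm \<epsilon> = 1"
  proof -
    have "norm \<epsilon> ^ 2 = 1" using arg_cong[OF e, of norm] by (simp add: norm_mult power2_eq_square)
    then show ?thesis by (metis norm_ge_zero power2_eq_1_iff zero_le_one neg_0_le_iff_le not_one_le_zero)
  qed
  define g where "g n = \<epsilon> ^ n * hyp_coeff a b c n * of_real x ^ n" for n
  define q where "q n = inverse (fps_const (of_nat n) + fps_X :: complex fps)" for n
  define H0 where "H0 = theta_sum \<epsilon> a b c 0 x"
  define H1 where "H1 = theta_sum \<epsilon> a b c 1 x"
  define N where "N n = fps_const (of_nat n :: complex)" for n
  have H0: "g sums H0"
    using summable_sums[OF summable_norm_cancel[OF hyp_coeff_power_sums(1)[OF c ne x]], of a b]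
    by (simp add: H0_def theta_sum_def g_def[abs_def])
  have H1: "(\<lambda>n. of_nat n * g n) sums H1"
    using summable_sums[OF summable_norm_cancel[OF hyp_coeff_power_sums(2)[OF c ne x]], of a b]
    by (simp add: H1_def theta_sum_def g_def[abs_def])
  have lin: "sums_coeffwise (\<lambda>n. fps_const (g n) * (N n + fps_const d - fps_X))
      (fps_const (H1 + d * H0) - fps_X * fps_const H0)" for d
  proof -
    have "fps_const (g n) * (N n + fps_const d - fps_X) = fps_const (of_nat n * g n + d * g n) - fps_X * fps_const (g n)" for n
      by (simp add: N_def algebra_simps flip: fps_const_add fps_const_mult)
    then show ?thesis
      by (simp only:) (intro sums_coeffwise_diff sums_coeffwise_mult sums_coeffwise_const sums_add sums_mult H0 H1)
  qed
  define G where "G n = fps_const (g n * of_nat n * (of_nat n + c - 1)) * q (n + j)" for n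
  have G: "sums_coeffwise G ((fps_const (of_nat j) + fps_X) * (fps_const (of_nat j + 1 - c) + fps_X)
        * moment_fps \<epsilon> a b c (j - 1) x + (fps_const (H1 + (c - 1 - of_nat j) * H0) - fps_X * fps_const H0))"
  proof -
    have G_eq: "G n = (fps_const (of_nat j) + fps_X) * (fps_const (of_nat j + 1 - c) + fps_X) * (fps_const (g n) * q (n + j))
       + fps_const (g n) * (N n + fps_const (c - 1 - of_nat j) - fps_X)" for n
    proof -
      have "(fps_const (of_nat (n + j)) + fps_X) * q (n + j) = (1 :: complex fps)"
        unfolding q_def using j by (intro inverse_shift_fps) (simp del: of_nat_add)
      note pf = partial_fraction_step[OF this, of "fps_const (of_nat j) + fps_X" "fps_const (of_nat j + 1 - c) + fps_X"]
      have 1: "fps_const (of_nat (n + j)) + fps_X - (fps_const (of_nat j) + fps_X) = N n"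
        by (simp add: N_def flip: fps_const_add)
      have 2: "fps_const (of_nat (n + j)) + fps_X - (fps_const (of_nat j + 1 - c) + fps_X) = fps_const (of_nat n + c - 1)"
        by (simp add: algebra_simps flip: fps_const_add fps_const_sub)
      have 3: "N n - (fps_const (of_nat j + 1 - c) + fps_X) = N n + fps_const (c - 1 - of_nat j) - fps_X"
        by (simp add: algebra_simps flip: fps_const_add fps_const_sub)
      have "G n = fps_const (g n) * (N n * fps_const (of_nat n + c - 1) * q (n + j))"
        by (simp add: G_def N_def mult_ac)
      also have "N n * fps_const (of_nat n + c - 1) * q (n + j) =
        (fps_const (of_nat j) + fps_X) * (fps_const (of_nat j + 1 - c) + fps_X) * q (n + j) +
          (N n + fps_const (c - 1 - of_nat j) - fps_X)"
        using pf unfolding 1 2 3 by (simp only: diff_add_cancel)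
      finally show ?thesis by (simp add: algebra_simps)
    qed
    have "sums_coeffwise (\<lambda>n. fps_const (g n) * q (n + j)) (moment_fps \<epsilon> a b c (j - 1) x)"
      using moment_fps_sums[OF c ne x, of a b "j - 1"] j by (simp add: g_def[abs_def] q_def)
    then show ?thesis unfolding G_eq[abs_def] by (intro sums_coeffwise_add sums_coeffwise_mult lin)
  qed
  \<comment> \<open>No boundary term arises from the shift, because \<open>G\<close> carries the factor \<open>n\<close>.\<close>
  have "G 0 = 0" by (simp add: G_def)
  note G_Suc = sums_coeffwise_mult[OF sums_coeffwise_Suc[OF G this], of "fps_const (\<epsilon> / of_real x)"]
  have shift: "fps_const (\<epsilon> / of_real x) * G (Suc n) = fps_const (g n * (of_nat n + a) * (of_nat n + b)) * q (n + j + 1)" for n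
  proof -
    have "\<epsilon> / of_real x * (g (Suc n) * of_nat (Suc n) * (of_nat (Suc n) + c - 1)) =
        (\<epsilon> * \<epsilon>) * \<epsilon> ^ n * of_real x ^ n * (hyp_coeff a b c (Suc n) * (of_nat n + 1) * (of_nat n + c))"
      using x by (simp add: g_def field_simps)
    also have "\<dots> = g n * (of_nat n + a) * (of_nat n + b)"
      unfolding e hyp_coeff_Suc[OF c] by (simp add: g_def)
    finally show ?thesis by (simp add: G_def mult.assoc[symmetric] del: of_nat_Suc)
  qed
  have lhs: "(fps_const (of_nat j + 1 - a) + fps_X) * (fps_const (of_nat j + 1 - b) + fps_X) * (fps_const (g n) * q (n + j + 1))
     = fps_const (\<epsilon> / of_real x) * G (Suc n) - fps_const (g n) * (N n + fps_const (a + b - of_nat j - 1) - fps_X)" for n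
  proof -
    have "(fps_const (of_nat (n + j + 1)) + fps_X) * q (n + j + 1) = (1 :: complex fps)"
      unfolding q_def by (intro inverse_shift_fps) (simp only: of_nat_eq_0_iff)
    note pf = partial_fraction_step[OF this, of "fps_const (of_nat j + 1 - a) + fps_X" "fps_const (of_nat j + 1 - b) + fps_X"]
    have 1: "fps_const (of_nat (n + j + 1)) + fps_X - (fps_const (of_nat j + 1 - d) + fps_X) = fps_const (of_nat n + d)" for d :: complex
      by (simp add: algebra_simps flip: fps_const_add fps_const_sub)
    have 3: "fps_const (of_nat n + a) - (fps_const (of_nat j + 1 - b) + fps_X) = N n + fps_const (a + b - of_nat j - 1) - fps_X"
      by (simp add: N_def algebra_simps flip: fps_const_add fps_const_sub)
    have "(fps_const (of_nat j + 1 - a) + fps_X) * (fps_const (of_nat j + 1 - b) + fps_X) * (fps_const (g n) * q (n + j + 1))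
      = fps_const (g n) * ((fps_const (of_nat j + 1 - a) + fps_X) * (fps_const (of_nat j + 1 - b) + fps_X) * q (n + j + 1))"
      by (simp only: mult_ac)
    also have "\<dots> = fps_const (g n) * (fps_const (of_nat n + a) * fps_const (of_nat n + b) * q (n + j + 1)
        - (N n + fps_const (a + b - of_nat j - 1) - fps_X))"
      unfolding pf 1 3 ..
    also have "\<dots> = fps_const (g n * (of_nat n + a) * (of_nat n + b)) * q (n + j + 1)
         - fps_const (g n) * (N n + fps_const (a + b - of_nat j - 1) - fps_X)"
      unfolding right_diff_distrib by (simp add: mult.assoc[symmetric])
    finally show ?thesis unfolding shift .
  qed
  have "sums_coeffwise (\<lambda>n. fps_const (g n) * q (n + j + 1)) (moment_fps \<epsilon> a b c j x)"
    using moment_fps_sums[OF c ne x, of a b j] by (simp only: g_def[abs_def] q_def)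
  from sums_coeffwise_mult[OF this, of "(fps_const (of_nat j + 1 - a) + fps_X) * (fps_const (of_nat j + 1 - b) + fps_X)"]
  have A: "sums_coeffwise (\<lambda>n. fps_const (\<epsilon> / of_real x) * G (Suc n) - fps_const (g n) * (N n + fps_const (a + b - of_nat j - 1) - fps_X))
    ((fps_const (of_nat j + 1 - a) + fps_X) * (fps_const (of_nat j + 1 - b) + fps_X) * moment_fps \<epsilon> a b c j x)"
    unfolding lhs .
  have "A = C * (B + P) - Q \<Longrightarrow> A = C * B + (C * P - Q)" for A B C P Q :: "complex fps"
    by (simp add: algebra_simps)
  from this[OF sums_coeffwise_unique[OF A sums_coeffwise_diff[OF G_Suc lin]]]
  show ?thesis unfolding boundary_fps_def H0_def[symmetric] H1_def[symmetric] .
qed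

section \<open>The limit of the inhomogeneity\<close>

lemma hyp_coeff_lower_decay:
  assumes c: "c \<notin> \<int>\<^sub>\<le>\<^sub>0" and r: "Re (c - a - b) > -1"
  shows "hyp_coeff a b c \<longlonglongrightarrow> 0"
    and "summable (\<lambda>n. norm (hyp_coeff a b c n / of_nat (Suc n)))"
proof -
  obtain B where B: "\<And>n. n \<ge> 1 \<Longrightarrow>
    norm (hyp_coeff a b c (Suc n)) \<le> B * real n powr (Re (a + b - c) - 1)"
    by (rule hyp_coeff_bound[OF c, of a b]) blast
  define p where "p = Re (a + b - c) - 1"
  have p: "p < 0" using r by (simp add: p_def)
  have "(\<lambda>n. hyp_coeff a b c (Suc n)) \<longlonglongrightarrow> 0"
  proof (rule Lim_null_comparison)
    show "\<forall>\<^sub>F n in sequentially. norm (hyp_coeff a b c (Suc n)) \<le> B * real n powr p"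
      using eventually_ge_at_top[of 1] by eventually_elim (use B p_def in auto)
    show "(\<lambda>n. B * real n powr p) \<longlonglongrightarrow> 0" using p by real_asymp
  qed
  then show "hyp_coeff a b c \<longlonglongrightarrow> 0" by (rule LIMSEQ_imp_Suc)
  have sm: "summable (\<lambda>n. B * real n powr (p - 1))"
    using p by (intro summable_mult) (simp add: summable_real_powr_iff)
  have "summable (\<lambda>n. norm (hyp_coeff a b c (Suc n) / of_nat (Suc (Suc n))))"
  proof (rule summable_comparison_test'[OF sm, of 1])
    fix n :: nat assume n: "1 \<le> n"
    have "norm (hyp_coeff a b c (Suc n) / of_nat (Suc (Suc n))) = norm (hyp_coeff a b c (Suc n)) / real (Suc (Suc n))"
      by (simp only: norm_divide norm_of_nat)
    also have "\<dots> \<le> norm (hyp_coeff a b c (Suc n)) / real n"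
      using n by (intro divide_left_mono) auto
    also have "\<dots> \<le> (B * real n powr p) / real n"
      using n B[OF n] unfolding p_def by (intro divide_right_mono) auto
    also have "\<dots> = B * real n powr (p - 1)" using n by (simp add: powr_diff)
    finally show "norm (norm (hyp_coeff a b c (Suc n) / of_nat (Suc (Suc n)))) \<le> B * real n powr (p - 1)"
      by (simp only: real_norm_def abs_norm_cancel)
  qed
  then show "summable (\<lambda>n. norm (hyp_coeff a b c n / of_nat (Suc n)))" by (subst (asm) summable_Suc_iff)
qed

lemma A_term_summable_plus:
  assumes c: "c \<notin> \<int>\<^sub>\<le>\<^sub>0" and r: "Re (c - a - b) > -1" and K: "K \<ge> 1"
  shows "summable (A_term 1 m K a b c)"
proof (rule summable_comparison_test'[OF hyp_coeff_lower_decay(2)[OF c r]])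
  fix n
  have "Suc n ^ 1 \<le> Suc n ^ K" using K by (intro power_increasing) auto
  also have "\<dots> \<le> (n + m + 1) ^ K" by (intro power_mono) auto
  finally have le: "real (Suc n) \<le> real ((n + m + 1) ^ K)" by (simp only: of_nat_le_iff power_one_right)
  have "norm (A_term 1 m K a b c n) = norm (hyp_coeff a b c n) / real ((n + m + 1) ^ K)"
    unfolding A_term_eq of_nat_power by (simp add: norm_divide norm_power del: of_nat_add) (metis norm_of_nat of_nat_1 of_nat_add)
  also have "\<dots> \<le> norm (hyp_coeff a b c n) / real (Suc n)"
    using le by (intro divide_left_mono) auto
  also have "\<dots> = norm (hyp_coeff a b c n / of_nat (Suc n))" by (simp only: norm_divide norm_of_nat)
  finally show "norm (A_term 1 m K a b c n) \<le> norm (hyp_coeff a b c n / of_nat (Suc n))" .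
qed

text \<open>
  The first combination is the Abel sum of the telescoping terms, whose series is a multiple of the
  Gauss series with parameter \<open>c + 1\<close>. In the range \<open>-1 < Re (c - a - b) \<le> 0\<close> its two summands need
  not converge separately.
\<close>
lemma boundary_limit_plus:
  assumes c: "c \<notin> \<int>\<^sub>\<le>\<^sub>0" and r: "Re (c - a - b) > -1"
  defines "H0 \<equiv> theta_sum 1 a b c 0" and "H1 \<equiv> theta_sum 1 a b c 1"
  shows "((\<lambda>x. (1 - of_real x) * H1 x + (c - a - b) * of_real x * H0 x)
      \<longlongrightarrow> Gamma c * Gamma (c - a - b + 1) * rGamma (c - a) * rGamma (c - b)) (at_left 1)"
    and "((\<lambda>x. (1 - of_real x) * H0 x) \<longlongrightarrow> 0) (at_left 1)"
proof -
  have c0: "c \<noteq> 0" using c by auto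
  have c1: "c + 1 \<notin> \<int>\<^sub>\<le>\<^sub>0" using nonpos_Ints_add_nat[OF c, of 1] by simp
  have r1: "Re (c + 1 - a - b) > 0" using r by simp
  define d where "d n = (c - a) * (c - b) / c * hyp_coeff a b (c + 1) n" for n
  have "d sums ((c - a) * (c - b) / c *
      (Gamma (c + 1) * Gamma (c + 1 - a - b) * rGamma (c + 1 - a) * rGamma (c + 1 - b)))"
    unfolding d_def by (intro sums_mult Gauss_summation[OF c1 r1])
  also have "(c - a) * (c - b) / c *
      (Gamma (c + 1) * Gamma (c + 1 - a - b) * rGamma (c + 1 - a) * rGamma (c + 1 - b)) =
      Gamma (c + 1) / c * Gamma (c - a - b + 1) * ((c - a) * rGamma (c - a + 1)) * ((c - b) * rGamma (c - b + 1))"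
  proof -
    have eqs: "c + 1 - a - b = c - a - b + 1" "c + 1 - a = c - a + 1" "c + 1 - b = c - b + 1" by simp_all
    show ?thesis unfolding eqs(1) unfolding eqs(2,3) by simp
  qed
  also have "\<dots> = Gamma c * Gamma (c - a - b + 1) * rGamma (c - a) * rGamma (c - b)"
    using c0 by (simp add: Gamma_plus1[OF c] rGamma_plus1)
  finally have lim: "((\<lambda>x. of_real x * (\<Sum>n. d n * of_real x ^ n))
      \<longlongrightarrow> of_real 1 * (Gamma c * Gamma (c - a - b + 1) * rGamma (c - a) * rGamma (c - b))) (at_left 1)"
    by (intro tendsto_intros Abel_limit)
  have ev: "\<forall>\<^sub>F x in at_left (1::real). x \<in> {0<..<1}"
    by (rule eventually_at_left_real) auto
  from ev have "\<forall>\<^sub>F x in at_left (1::real). of_real x * (\<Sum>n. d n * of_real x ^ n) =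
      (1 - of_real x) * H1 x + (c - a - b) * of_real x * H0 x"
  proof eventually_elim
    case (elim x)
    then have x: "0 < x" "x < 1" by auto
    define g where "g n = hyp_coeff a b c n * of_real x ^ n" for n
    note s = hyp_coeff_power_sums[OF c _ x, of 1 a b, simplified, THEN summable_norm_cancel]
    have s0: "g sums H0 x"
      using s(1) by (simp add: sums_iff H0_def theta_sum_def g_def[abs_def])
    have s1: "(\<lambda>n. of_nat n * g n) sums H1 x"
      using s(2) by (simp add: sums_iff H1_def theta_sum_def g_def[abs_def])
    have s2: "(\<lambda>n. of_nat (Suc n) * g (Suc n)) sums H1 x"
      using s1 by (subst sums_Suc_iff) simp
    have "of_nat (Suc n) * g (Suc n) - of_real x * (of_nat n * g n) + (c - a - b) * of_real x * g n
        = of_real x * (d n * of_real x ^ n)" for n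
      unfolding d_def hyp_coeff_telescope[OF c, symmetric] by (simp add: g_def algebra_simps)
    with sums_add[OF sums_diff[OF s2 sums_mult[OF s1, of "of_real x"]] sums_mult[OF s0, of "(c - a - b) * of_real x"]]
    have "(\<lambda>n. of_real x * (d n * of_real x ^ n)) sums (H1 x - of_real x * H1 x + (c - a - b) * of_real x * H0 x)"
      by simp
    moreover have "summable (\<lambda>n. d n * of_real x ^ n)"
    proof -
      note hyp_coeff_power_sums(1)[OF c1 _ x, of 1 a b, simplified, THEN summable_norm_cancel]
      then have "summable (\<lambda>n. (c - a) * (c - b) / c * (hyp_coeff a b (c + 1) n * of_real x ^ n))"
        by (rule summable_mult)
      then show ?thesis by (simp add: d_def mult.assoc)
    qed
    ultimately show ?case by (simp add: sums_iff suminf_mult algebra_simps)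
  qed
  from Lim_transform_eventually[OF lim this]
  show "((\<lambda>x. (1 - of_real x) * H1 x + (c - a - b) * of_real x * H0 x)
      \<longlongrightarrow> Gamma c * Gamma (c - a - b + 1) * rGamma (c - a) * rGamma (c - b)) (at_left 1)"
    by simp
  show "((\<lambda>x. (1 - of_real x) * H0 x) \<longlongrightarrow> 0) (at_left 1)"
    using Abel_means[OF hyp_coeff_lower_decay(1)[OF c r]] by (simp add: H0_def theta_sum_def[abs_def])
qed

text \<open>
  The point \<open>-1\<close> lies inside the domain of holomorphy, so the values of the function and its
  derivative at \<open>-x\<close> converge, whether or not the series converges at \<open>-1\<close>.
\<close>
lemma boundary_limit_minus:
  assumes c: "c \<notin> \<int>\<^sub>\<le>\<^sub>0"
  shows "(theta_sum (-1) a b c 0 \<longlongrightarrow> hyp2F1 a b c (-1)) (at_left 1)"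
    and "(theta_sum (-1) a b c 1 \<longlongrightarrow> - deriv (hyp2F1 a b c) (-1)) (at_left 1)"
proof -
  let ?D = "- complex_of_real ` {1..}"
  have D: "-1 \<in> ?D"
    by (auto simp: complex_eq_iff)
  note hol = hyp2F1_holomorphic[OF c, of a b]
  note hol' = holomorphic_deriv[OF hol open_slit_plane]
  have cont: "isCont f (-1)" if "f holomorphic_on ?D" for f
    using that D open_slit_plane continuous_on_eq_continuous_at holomorphic_on_imp_continuous_on by blast
  have lim: "((\<lambda>x. - of_real x :: complex) \<longlongrightarrow> -1) (at_left 1)"
    by (rule tendsto_eq_intros refl | simp)+
  have ev: "\<forall>\<^sub>F x in at_left (1::real). x \<in> {0<..<1}"
    by (rule eventually_at_left_real) auto
  have "((\<lambda>x. hyp2F1 a b c (- of_real x)) \<longlongrightarrow> hyp2F1 a b c (-1)) (at_left 1)"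
    by (rule isCont_tendsto_compose[OF cont[OF hol] lim])
  moreover from ev have "\<forall>\<^sub>F x in at_left 1. hyp2F1 a b c (- of_real x) = theta_sum (-1) a b c 0 x"
  proof eventually_elim
    case (elim x)
    then have "norm (- of_real x :: complex) < 1" by auto
    from hyp2F1_sums[OF c this, of a b] show ?case
      by (simp add: sums_iff theta_sum_def power_minus[of "of_real x"] mult_ac)
  qed
  ultimately show "(theta_sum (-1) a b c 0 \<longlongrightarrow> hyp2F1 a b c (-1)) (at_left 1)"
    by (rule Lim_transform_eventually)
  have "((\<lambda>x. - of_real x * deriv (hyp2F1 a b c) (- of_real x)) \<longlongrightarrow> -1 * deriv (hyp2F1 a b c) (-1)) (at_left 1)"
    by (intro tendsto_mult lim isCont_tendsto_compose[OF cont[OF hol'] lim])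
  moreover from ev have "\<forall>\<^sub>F x in at_left 1. - of_real x * deriv (hyp2F1 a b c) (- of_real x) = theta_sum (-1) a b c 1 x"
  proof eventually_elim
    case (elim x)
    define F where "F = Abs_fps (hyp_coeff a b c)"
    define z where "z = (- of_real x :: complex)"
    have z: "norm z < 1" using elim by (auto simp: z_def)
    have R: "fps_conv_radius F \<ge> 1" using conv_radius_hyp_coeff[OF c] by (simp add: F_def fps_conv_radius_def)
    then have r: "ereal (norm z) < fps_conv_radius F" using z by (auto intro: less_le_trans[of _ 1])
    have "\<forall>\<^sub>F w in nhds z. w \<in> ball 0 1" using z by (intro eventually_nhds_in_open) auto
    then have "\<forall>\<^sub>F w in nhds z. hyp2F1 a b c w = eval_fps F w"
      by eventually_elim (use hyp2F1_sums[OF c] in \<open>auto simp: sums_iff eval_fps_def F_def\<close>)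
    then have "deriv (hyp2F1 a b c) z = deriv (eval_fps F) z"
      by (intro deriv_cong_ev) auto
    also have "\<dots> = eval_fps (fps_deriv F) z"
      using eval_fps_deriv[OF r] by simp
    finally have d: "deriv (hyp2F1 a b c) z = eval_fps (fps_deriv F) z" .
    have "(\<lambda>n. fps_nth (fps_deriv F) n * z ^ n) sums eval_fps (fps_deriv F) z"
      using r fps_conv_radius_deriv[of F] by (intro sums_eval_fps) (auto intro: less_le_trans)
    from sums_mult[OF this, of z] have "(\<lambda>n. of_nat (Suc n) * (hyp_coeff a b c (Suc n) * z ^ Suc n)) sums (z * eval_fps (fps_deriv F) z)"
      by (simp add: F_def mult_ac)
    then have "(\<lambda>n. of_nat n * (hyp_coeff a b c n * z ^ n)) sums (z * eval_fps (fps_deriv F) z)"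
      by (subst (asm) sums_Suc_iff) simp
    moreover have "z ^ n = (-1) ^ n * of_real x ^ n" for n unfolding z_def by (rule power_minus)
    ultimately show ?case unfolding z_def[symmetric] d theta_sum_def by (simp add: sums_iff mult_ac)
  qed
  ultimately show "(theta_sum (-1) a b c 1 \<longlongrightarrow> - deriv (hyp2F1 a b c) (-1)) (at_left 1)"
    by (simp only: mult_minus1) (rule Lim_transform_eventually)
qed

lemma boundary_fps_nth:
  "fps_nth (boundary_fps \<epsilon> a b c j x) k =
    (if k = 0 then \<epsilon> / of_real x * (theta_sum \<epsilon> a b c 1 x + (c - 1 - of_nat j) * theta_sum \<epsilon> a b c 0 x)
        - (theta_sum \<epsilon> a b c 1 x + (a + b - of_nat j - 1) * theta_sum \<epsilon> a b c 0 x)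
     else if k = 1 then (1 - \<epsilon> / of_real x) * theta_sum \<epsilon> a b c 0 x else 0)"
  by (auto simp: boundary_fps_def fps_X_mult_nth algebra_simps)

lemma fps_X_expansion_linear:
  "fps_expansion (\<lambda>x. \<alpha> + \<beta> * x) 0 = fps_const \<alpha> + fps_const \<beta> * fps_X"
  by (intro fps_expansion_eqI fps_expansion_intros)

text \<open>
  For \<open>\<epsilon> = 1\<close> the constant coefficient is \<open>1 / x\<close> times the combination with the Gamma limit, up to a
  multiple of \<open>1 - x\<close> times the series itself; that multiple and the linear coefficient vanish in the
  limit, which is why the limit does not depend on \<open>j\<close>. For \<open>\<epsilon> = -1\<close> the linear
  coefficient tends to twice the value of the Gauss function at \<open>-1\<close>, which accounts for the
  dependence of \<open>E\<close> on \<open>M\<close>.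
\<close>
lemma boundary_fps_tendsto:
  assumes c: "c \<notin> \<int>\<^sub>\<le>\<^sub>0" and e: "\<epsilon> \<in> {1, -1}" and r: "\<epsilon> = 1 \<Longrightarrow> Re (c - a - b) > -1"
  shows "((\<lambda>x. fps_nth (boundary_fps \<epsilon> a b c j x) k) \<longlongrightarrow> \<epsilon> * e_coeff \<epsilon> j a b c k) (at_left 1)"
proof -
  have ev: "\<forall>\<^sub>F x in at_left (1::real). x \<in> {0<..<1}"
    by (rule eventually_at_left_real) auto
  have inv: "((\<lambda>x. z / of_real x) \<longlongrightarrow> z) (at_left 1)" for z :: complex
    by (rule tendsto_eq_intros refl | simp)+
  have one: "((\<lambda>x. 1 - of_real x :: complex) \<longlongrightarrow> 0) (at_left 1)"
    by (rule tendsto_eq_intros refl | simp)+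
  show ?thesis
  proof (cases "\<epsilon> = 1")
    case True
    note lim = boundary_limit_plus[OF c r[OF True]]
    have "e_coeff \<epsilon> j a b c k = fps_nth (fps_expansion (\<lambda>x. E_plus 0 a b c + 0 * x) 0) k"
      by (simp add: e_coeff_def E_fun_def True E_plus_def)
    then have ek: "e_coeff \<epsilon> j a b c k = (if k = 0 then E_plus 0 a b c else 0)"
      unfolding fps_X_expansion_linear by simp
    let ?H0 = "theta_sum 1 a b c 0" and ?H1 = "theta_sum 1 a b c 1"
    consider "k = 0" | "k = 1" | "k > 1" by linarith
    then show ?thesis
    proof cases
      case 1
      have "((\<lambda>x. 1 / of_real x * (((1 - of_real x) * ?H1 x + (c - a - b) * of_real x * ?H0 x)
         + (c - 1 - of_nat j) * ((1 - of_real x) * ?H0 x))) \<longlongrightarrow> 1 * (E_plus 0 a b c + (c - 1 - of_nat j) * 0)) (at_left 1)"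
        unfolding E_plus_def by (intro tendsto_mult tendsto_add inv tendsto_const lim)
      moreover from ev have "\<forall>\<^sub>F x in at_left 1. 1 / of_real x * (((1 - of_real x) * ?H1 x + (c - a - b) * of_real x * ?H0 x)
         + (c - 1 - of_nat j) * ((1 - of_real x) * ?H0 x)) = fps_nth (boundary_fps \<epsilon> a b c j x) k"
        by eventually_elim (simp add: boundary_fps_nth 1 True field_simps)
      ultimately show ?thesis unfolding ek by (rule Lim_transform_eventually[THEN tendsto_eq_rhs]) (simp add: 1 True)
    next
      case 2
      have "((\<lambda>x. - 1 / of_real x * ((1 - of_real x) * ?H0 x)) \<longlongrightarrow> -1 * 0) (at_left 1)"
        by (intro tendsto_mult inv lim)
      moreover from ev have "\<forall>\<^sub>F x in at_left 1. - 1 / of_real x * ((1 - of_real x) * ?H0 x) = fps_nth (boundary_fps \<epsilon> a b c j x) k"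
        by eventually_elim (simp add: boundary_fps_nth 2 True field_simps)
      ultimately show ?thesis unfolding ek by (rule Lim_transform_eventually[THEN tendsto_eq_rhs]) (simp add: 2)
    qed (simp add: boundary_fps_nth ek)
  next
    case False
    then have em: "\<epsilon> = -1" using e by auto
    note lim = boundary_limit_minus[OF c, of a b]
    let ?F = "hyp2F1 a b c (-1)" and ?F' = "deriv (hyp2F1 a b c) (-1)"
    have "e_coeff \<epsilon> j a b c k = fps_nth (fps_expansion (\<lambda>x. ((c + a + b - 2 * of_nat j - 2) * ?F - 2 * ?F') + (-2 * ?F) * x) 0) k"
      by (simp add: e_coeff_def E_fun_def em E_minus_def algebra_simps)
    then have ek: "e_coeff \<epsilon> j a b c k = (if k = 0 then (c + a + b - 2 * of_nat j - 2) * ?F - 2 * ?F' else if k = 1 then -2 * ?F else 0)"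
      unfolding fps_X_expansion_linear by (auto simp: fps_X_def)
    have "((\<lambda>x. fps_nth (boundary_fps (-1) a b c j x) k) \<longlongrightarrow>
       (if k = 0 then (-1) * (- ?F' + (c - 1 - of_nat j) * ?F) - (- ?F' + (a + b - of_nat j - 1) * ?F)
        else if k = 1 then (1 - (-1)) * ?F else 0)) (at_left 1)"
      unfolding boundary_fps_nth
      by (cases "k = 0"; cases "k = 1"; simp only: if_True if_False refl zero_neq_one one_neq_zero)
         (intro tendsto_intros inv lim)+
    then show ?thesis unfolding ek unfolding em by (rule tendsto_eq_rhs) (auto simp: algebra_simps)
  qed
qed

section \<open>Limits of finitely many coefficients\<close>

text \<open>
  Convergence is recorded for the coefficients below \<open>K\<close> only, because the undamped series are
  assumed to converge for the exponents up to \<open>K\<close> only. Products respect this truncation.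
\<close>
definition coeffs_tendsto :: "nat \<Rightarrow> (real \<Rightarrow> complex fps) \<Rightarrow> complex fps \<Rightarrow> real filter \<Rightarrow> bool" where
  "coeffs_tendsto K F G \<F> \<longleftrightarrow> (\<forall>k<K. ((\<lambda>x. fps_nth (F x) k) \<longlongrightarrow> fps_nth G k) \<F>)"

lemma coeffs_tendsto_mult:
  assumes "coeffs_tendsto K F F' \<F>" "coeffs_tendsto K G G' \<F>"
  shows "coeffs_tendsto K (\<lambda>x. F x * G x) (F' * G') \<F>"
  using assms unfolding coeffs_tendsto_def fps_mult_nth by (auto intro!: tendsto_sum tendsto_mult)

lemma coeffs_tendsto_add:
  assumes "coeffs_tendsto K F F' \<F>" "coeffs_tendsto K G G' \<F>"
  shows "coeffs_tendsto K (\<lambda>x. F x + G x) (F' + G') \<F>"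
  using assms unfolding coeffs_tendsto_def by (auto intro!: tendsto_add)

lemma coeffs_tendsto_const: "coeffs_tendsto K (\<lambda>_. G) G \<F>"
  unfolding coeffs_tendsto_def by auto

lemma coeffs_tendsto_fps_const:
  assumes "(f \<longlongrightarrow> l) \<F>" shows "coeffs_tendsto K (\<lambda>x. fps_const (f x)) (fps_const l) \<F>"
  using assms unfolding coeffs_tendsto_def by auto

section \<open>The rational functions of the solved recurrence\<close>

lemma pochhammer_shift_nonzero:
  fixes a :: complex
  assumes "\<forall>j\<in>{1..m}. of_nat j + 1 - a \<noteq> 0" and i: "i \<ge> 1" and n: "i + n \<le> Suc m"
  shows "pochhammer (of_nat i + 1 - a) n \<noteq> 0"
proof -
  have "of_nat i + 1 - a + of_nat k \<noteq> 0" if "k < n" for k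
    using bspec[OF assms(1), of "i + k"] that i n by (auto simp: algebra_simps)
  then show ?thesis by (auto simp: pochhammer_prod)
qed

definition pochhammer_fps :: "complex \<Rightarrow> nat \<Rightarrow> complex fps" where
  "pochhammer_fps \<alpha> n = pochhammer (fps_const \<alpha> + fps_X) n"

lemma pochhammer_fps_Suc:
  "pochhammer_fps \<alpha> (Suc n) = pochhammer_fps \<alpha> n * (fps_const (\<alpha> + of_nat n) + fps_X)"
  by (simp add: pochhammer_fps_def pochhammer_Suc fps_of_nat[symmetric] algebra_simps flip: fps_const_add)

definition R_fps :: "complex \<Rightarrow> nat \<Rightarrow> complex \<Rightarrow> complex \<Rightarrow> complex \<Rightarrow> complex fps" where
  "R_fps \<epsilon> m a b c = fps_expansion (R_fun \<epsilon> m a b c) 0"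

definition T_fps :: "complex \<Rightarrow> nat \<Rightarrow> nat \<Rightarrow> complex \<Rightarrow> complex \<Rightarrow> complex \<Rightarrow> complex fps" where
  "T_fps \<epsilon> m j a b c = fps_expansion (T_fun \<epsilon> m j a b c) 0"

lemma quotient_fps_expansion:
  assumes "pochhammer \<gamma> p \<noteq> 0" "pochhammer \<delta> p \<noteq> 0"
  shows "fps_expansion (\<lambda>x. z * (pochhammer (\<alpha> + x) n * pochhammer (\<beta> + x) n) / (pochhammer (\<gamma> + x) p * pochhammer (\<delta> + x) p)) 0
     * (pochhammer_fps \<gamma> p * pochhammer_fps \<delta> p) = fps_const z * (pochhammer_fps \<alpha> n * pochhammer_fps \<beta> n)"
proof -
  define N D where "N = fps_const z * (pochhammer_fps \<alpha> n * pochhammer_fps \<beta> n)"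
    and "D = pochhammer_fps \<gamma> p * pochhammer_fps \<delta> p"
  have D0: "fps_nth D 0 \<noteq> 0" using assms by (simp add: D_def pochhammer_fps_def fps_pochhammer_nth_0)
  have "(\<lambda>x. z * (pochhammer (\<alpha> + x) n * pochhammer (\<beta> + x) n) / (pochhammer (\<gamma> + x) p * pochhammer (\<delta> + x) p))
      has_fps_expansion N / D"
    unfolding N_def D_def pochhammer_fps_def
    by (intro fps_expansion_intros pochhammer_has_fps_expansion)
       (use D0 in \<open>simp add: D_def pochhammer_fps_def\<close>)
  from fps_expansion_eqI[OF this] have "fps_expansion (\<lambda>x. z * (pochhammer (\<alpha> + x) n * pochhammer (\<beta> + x) n) / (pochhammer (\<gamma> + x) p * pochhammer (\<delta> + x) p)) 0 = N / D" .
  moreover have "N / D * D = N" using D0 by (simp add: fps_divide_unit mult.assoc inverse_mult_eq_1)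
  ultimately show ?thesis by (simp only: N_def D_def)
qed

lemma pochhammer_fps_nonzero: "pochhammer \<alpha> n \<noteq> 0 \<Longrightarrow> pochhammer_fps \<alpha> n \<noteq> 0"
  by (metis fps_pochhammer_nth_0 fps_zero_nth pochhammer_fps_def)

text \<open>
  Common to both families: lengthening the Pochhammer symbols by one adds one linear factor
  to each of them.
\<close>
lemma expansion_step:
  assumes "\<gamma>' = \<gamma> + of_nat p" "\<delta>' = \<delta> + of_nat p" "\<alpha>' = \<alpha> + of_nat n" "\<beta>' = \<beta> + of_nat n"
    and nz: "pochhammer \<gamma> (Suc p) \<noteq> 0" "pochhammer \<delta> (Suc p) \<noteq> 0"
  shows "(fps_const \<gamma>' + fps_X) * (fps_const \<delta>' + fps_X) *
     fps_expansion (\<lambda>x. \<epsilon> ^ Suc q * (pochhammer (\<alpha> + x) (Suc n) * pochhammer (\<beta> + x) (Suc n)) /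
          (pochhammer (\<gamma> + x) (Suc p) * pochhammer (\<delta> + x) (Suc p))) 0 =
    fps_const \<epsilon> * ((fps_const \<alpha>' + fps_X) * (fps_const \<beta>' + fps_X) *
     fps_expansion (\<lambda>x. \<epsilon> ^ q * (pochhammer (\<alpha> + x) n * pochhammer (\<beta> + x) n) /
          (pochhammer (\<gamma> + x) p * pochhammer (\<delta> + x) p)) 0)"
    (is "?g * ?d * ?F' = _ * (?a * ?b * ?F)")
proof -
  have nz': "pochhammer \<gamma> p \<noteq> 0" "pochhammer \<delta> p \<noteq> 0" using nz by (auto simp: pochhammer_Suc)
  define D where "D = pochhammer_fps \<gamma> p * pochhammer_fps \<delta> p"
  have D: "D \<noteq> 0" using nz' by (simp add: D_def pochhammer_fps_nonzero)
  have "D * (?g * ?d * ?F') = ?F' * (pochhammer_fps \<gamma> (Suc p) * pochhammer_fps \<delta> (Suc p))"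
    unfolding pochhammer_fps_Suc assms(1,2) D_def by (simp only: mult_ac)
  also have "\<dots> = fps_const (\<epsilon> ^ Suc q) * (pochhammer_fps \<alpha> (Suc n) * pochhammer_fps \<beta> (Suc n))"
    by (rule quotient_fps_expansion[OF nz])
  also have "\<dots> = fps_const \<epsilon> * ?a * ?b * (fps_const (\<epsilon> ^ q) * (pochhammer_fps \<alpha> n * pochhammer_fps \<beta> n))"
    unfolding pochhammer_fps_Suc assms(3,4) power_Suc fps_const_mult[symmetric] by (simp only: mult_ac)
  also have "\<dots> = fps_const \<epsilon> * ?a * ?b * (?F * D)"
    unfolding D_def quotient_fps_expansion[OF nz'] ..
  also have "\<dots> = D * (fps_const \<epsilon> * (?a * ?b * ?F))" by (simp only: mult_ac)
  finally show ?thesis using D by (simp only: mult_cancel_left) simp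
qed

lemma R_fps_0: "R_fps \<epsilon> 0 a b c = 1"
proof -
  have "R_fun \<epsilon> 0 a b c = (\<lambda>_. 1)" by (simp add: R_fun_def fun_eq_iff)
  then show ?thesis unfolding R_fps_def by (simp only:) (intro fps_expansion_eqI has_fps_expansion_1)
qed

lemma R_fps_step:
  assumes a: "\<forall>j\<in>{1..Suc m}. of_nat j + 1 - a \<noteq> 0"
    and b: "\<forall>j\<in>{1..Suc m}. of_nat j + 1 - b \<noteq> 0"
  shows "(fps_const (of_nat (Suc m) + 1 - a) + fps_X) * (fps_const (of_nat (Suc m) + 1 - b) + fps_X) * R_fps \<epsilon> (Suc m) a b c
    = fps_const \<epsilon> * ((fps_const (of_nat (Suc m)) + fps_X) * (fps_const (of_nat (Suc m) + 1 - c) + fps_X) * R_fps \<epsilon> m a b c)"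
  unfolding R_fps_def R_fun_def
  using pochhammer_shift_nonzero[OF a, of 1 "Suc m"] pochhammer_shift_nonzero[OF b, of 1 "Suc m"]
  by (intro expansion_step) auto

lemma T_fps_step:
  assumes a: "\<forall>j\<in>{1..Suc m}. of_nat j + 1 - a \<noteq> 0"
    and b: "\<forall>j\<in>{1..Suc m}. of_nat j + 1 - b \<noteq> 0" and i: "i \<in> {1..m}"
  shows "(fps_const (of_nat (Suc m) + 1 - a) + fps_X) * (fps_const (of_nat (Suc m) + 1 - b) + fps_X) * T_fps \<epsilon> (Suc m) i a b c
    = fps_const \<epsilon> * ((fps_const (of_nat (Suc m)) + fps_X) * (fps_const (of_nat (Suc m) + 1 - c) + fps_X) * T_fps \<epsilon> m i a b c)"
proof -
  have s: "Suc m - i = Suc (m - i)" using i by auto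
  have p: "of_nat (m - i) = (of_nat m - of_nat i :: complex)" using i by (simp add: of_nat_diff)
  show ?thesis
    unfolding T_fps_def T_fun_def s Suc_eq_plus1[symmetric]
    using i pochhammer_shift_nonzero[OF a, of i "Suc (Suc (m - i))"] pochhammer_shift_nonzero[OF b, of i "Suc (Suc (m - i))"]
    by (intro expansion_step) (auto simp: p)
qed

lemma T_fps_diag:
  assumes a: "of_nat m + 1 - a \<noteq> 0" and b: "of_nat m + 1 - b \<noteq> 0"
  shows "(fps_const (of_nat m + 1 - a) + fps_X) * (fps_const (of_nat m + 1 - b) + fps_X) * T_fps \<epsilon> m m a b c = fps_const \<epsilon>"
  using quotient_fps_expansion[of "of_nat m + 1 - a" 1 "of_nat m + 1 - b" \<epsilon> "of_nat m + 1" 0 "of_nat m + 2 - c"] a b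
  by (simp add: T_fps_def T_fun_def[abs_def] pochhammer_fps_def mult_ac)

section \<open>Solving the recurrence\<close>

text \<open>
  The solution of the undamped recurrence that starts at \<open>m = 0\<close> with the values \<open>A\<^sub>0\<close>. A divergent
  series would contribute an arbitrary value to its own and higher coefficients only.
\<close>
definition limit_fps :: "complex \<Rightarrow> complex \<Rightarrow> complex \<Rightarrow> complex \<Rightarrow> nat \<Rightarrow> complex fps" where
  "limit_fps \<epsilon> a b c m = R_fps \<epsilon> m a b c * Abs_fps (\<lambda>k. (-1) ^ k * A_sum \<epsilon> 0 (Suc k) a b c)
     + (\<Sum>j = 1..m. T_fps \<epsilon> m j a b c * Abs_fps (e_coeff \<epsilon> j a b c))"

lemma limit_fps_step:
  assumes a: "\<forall>j\<in>{1..Suc m}. of_nat j + 1 - a \<noteq> 0"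
    and b: "\<forall>j\<in>{1..Suc m}. of_nat j + 1 - b \<noteq> 0"
  shows "(fps_const (of_nat (Suc m) + 1 - a) + fps_X) * (fps_const (of_nat (Suc m) + 1 - b) + fps_X) * limit_fps \<epsilon> a b c (Suc m)
    = fps_const \<epsilon> * ((fps_const (of_nat (Suc m)) + fps_X) * (fps_const (of_nat (Suc m) + 1 - c) + fps_X) * limit_fps \<epsilon> a b c m)
      + fps_const \<epsilon> * Abs_fps (e_coeff \<epsilon> (Suc m) a b c)"
proof -
  define D where "D = (fps_const (of_nat (Suc m) + 1 - a) + fps_X) * (fps_const (of_nat (Suc m) + 1 - b) + fps_X)"
  define B where "B = fps_const \<epsilon> * ((fps_const (of_nat (Suc m)) + fps_X) * (fps_const (of_nat (Suc m) + 1 - c) + fps_X))"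
  let ?A = "Abs_fps (\<lambda>k. (-1) ^ k * A_sum \<epsilon> 0 (Suc k) a b c)"
  let ?E = "\<lambda>j. Abs_fps (e_coeff \<epsilon> j a b c)"
  have R: "D * R_fps \<epsilon> (Suc m) a b c = B * R_fps \<epsilon> m a b c"
    using R_fps_step[OF a b, of \<epsilon> c] by (simp only: D_def B_def mult.assoc)
  have T: "D * T_fps \<epsilon> (Suc m) i a b c = B * T_fps \<epsilon> m i a b c" if "i \<in> {1..m}" for i
    using T_fps_step[OF a b that, of \<epsilon> c] by (simp only: D_def B_def mult.assoc)
  have Td: "D * T_fps \<epsilon> (Suc m) (Suc m) a b c = fps_const \<epsilon>"
    unfolding D_def using bspec[OF a, of "Suc m"] bspec[OF b, of "Suc m"] by (intro T_fps_diag) auto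
  have "D * limit_fps \<epsilon> a b c (Suc m) = D * R_fps \<epsilon> (Suc m) a b c * ?A
     + (\<Sum>j = 1..m. D * T_fps \<epsilon> (Suc m) j a b c * ?E j) + D * T_fps \<epsilon> (Suc m) (Suc m) a b c * ?E (Suc m)"
    by (simp add: limit_fps_def distrib_left sum_distrib_left mult.assoc)
  also have "(\<Sum>j = 1..m. D * T_fps \<epsilon> (Suc m) j a b c * ?E j) = (\<Sum>j = 1..m. B * T_fps \<epsilon> m j a b c * ?E j)"
    by (intro sum.cong refl) (simp only: T)
  also have "D * R_fps \<epsilon> (Suc m) a b c * ?A + (\<Sum>j = 1..m. B * T_fps \<epsilon> m j a b c * ?E j) + D * T_fps \<epsilon> (Suc m) (Suc m) a b c * ?E (Suc m)
     = B * limit_fps \<epsilon> a b c m + fps_const \<epsilon> * ?E (Suc m)"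
    unfolding R Td by (simp add: limit_fps_def distrib_left sum_distrib_left mult.assoc)
  finally show ?thesis by (simp only: D_def B_def mult.assoc)
qed

lemma moment_fps_nth_tendsto:
  assumes "summable (A_term \<epsilon> j (Suc k) a b c)"
  shows "((\<lambda>x. fps_nth (moment_fps \<epsilon> a b c j x) k) \<longlongrightarrow> (-1) ^ k * A_sum \<epsilon> j (Suc k) a b c) (at_left 1)"
  unfolding moment_fps_def fps_nth_Abs_fps A_sum_def
  by (intro tendsto_intros Abel_limit summable_sums assms)

text \<open>
  Induction along the recurrence: the factor in front of the new series is a unit, since its constant
  coefficient \<open>(m + 1 - a)(m + 1 - b)\<close> is nonzero, so convergence of the coefficients is inherited from
  the previous series and the inhomogeneity.
\<close>
lemma moment_fps_tendsto:
  assumes c: "c \<notin> \<int>\<^sub>\<le>\<^sub>0" and e: "\<epsilon> \<in> {1, -1}" and r: "\<epsilon> = 1 \<Longrightarrow> Re (c - a - b) > -1"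
    and sm: "\<And>k. k \<in> {1..K} \<Longrightarrow> summable (A_term \<epsilon> 0 k a b c)"
    and a: "\<forall>j\<in>{1..m}. of_nat j + 1 - a \<noteq> 0"
    and b: "\<forall>j\<in>{1..m}. of_nat j + 1 - b \<noteq> 0"
  shows "coeffs_tendsto K (moment_fps \<epsilon> a b c m) (limit_fps \<epsilon> a b c m) (at_left 1)"
  using a b
proof (induction m)
  case 0
  show ?case unfolding coeffs_tendsto_def
    using moment_fps_nth_tendsto[OF sm] by (auto simp: limit_fps_def R_fps_0)
next
  case (Suc m)
  define D where "D = (fps_const (of_nat (Suc m) + 1 - a) + fps_X) * (fps_const (of_nat (Suc m) + 1 - b) + fps_X)"
  define B where "B = (fps_const (of_nat (Suc m)) + fps_X) * (fps_const (of_nat (Suc m) + 1 - c) + fps_X)"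
  have D: "inverse D * D = 1"
    using bspec[OF Suc.prems(1), of "Suc m"] bspec[OF Suc.prems(2), of "Suc m"]
    by (intro inverse_mult_eq_1) (auto simp: D_def)
  have IH: "coeffs_tendsto K (moment_fps \<epsilon> a b c m) (limit_fps \<epsilon> a b c m) (at_left 1)"
    using Suc.prems by (intro Suc.IH) auto
  have inv: "((\<lambda>x. \<epsilon> / of_real x) \<longlongrightarrow> \<epsilon>) (at_left 1)"
    by (rule tendsto_eq_intros refl | simp)+
  have bd: "coeffs_tendsto K (boundary_fps \<epsilon> a b c (Suc m)) (fps_const \<epsilon> * Abs_fps (e_coeff \<epsilon> (Suc m) a b c)) (at_left 1)"
    unfolding coeffs_tendsto_def using boundary_fps_tendsto[OF c e r] by auto
  have "coeffs_tendsto K (\<lambda>x. inverse D * (fps_const (\<epsilon> / of_real x) * (B * moment_fps \<epsilon> a b c m x) + boundary_fps \<epsilon> a b c (Suc m) x))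
     (inverse D * (fps_const \<epsilon> * (B * limit_fps \<epsilon> a b c m) + fps_const \<epsilon> * Abs_fps (e_coeff \<epsilon> (Suc m) a b c))) (at_left 1)"
    by (intro coeffs_tendsto_mult coeffs_tendsto_add coeffs_tendsto_const coeffs_tendsto_fps_const inv IH bd)
  also have "inverse D * (fps_const \<epsilon> * (B * limit_fps \<epsilon> a b c m) + fps_const \<epsilon> * Abs_fps (e_coeff \<epsilon> (Suc m) a b c))
      = inverse D * (D * limit_fps \<epsilon> a b c (Suc m))"
    unfolding D_def B_def by (subst limit_fps_step[OF Suc.prems]) auto
  also have "\<dots> = limit_fps \<epsilon> a b c (Suc m)" unfolding mult.assoc[symmetric] D by simp
  finally have lim: "coeffs_tendsto K (\<lambda>x. inverse D * (fps_const (\<epsilon> / of_real x) * (B * moment_fps \<epsilon> a b c m x) + boundary_fps \<epsilon> a b c (Suc m) x))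
     (limit_fps \<epsilon> a b c (Suc m)) (at_left 1)" .
  have "\<forall>\<^sub>F x in at_left (1::real). x \<in> {0<..<1}"
    by (rule eventually_at_left_real) auto
  then have ev: "\<forall>\<^sub>F x in at_left (1::real). inverse D * (fps_const (\<epsilon> / of_real x) * (B * moment_fps \<epsilon> a b c m x) + boundary_fps \<epsilon> a b c (Suc m) x)
     = moment_fps \<epsilon> a b c (Suc m) x"
  proof eventually_elim
    case (elim x)
    have "D * moment_fps \<epsilon> a b c (Suc m) x = fps_const (\<epsilon> / of_real x) * (B * moment_fps \<epsilon> a b c m x) + boundary_fps \<epsilon> a b c (Suc m) x"
      using moment_fps_recurrence[OF c _ _ _, of \<epsilon> x "Suc m" a b] elim e unfolding D_def B_def by auto
    then have "inverse D * (fps_const (\<epsilon> / of_real x) * (B * moment_fps \<epsilon> a b c m x) + boundary_fps \<epsilon> a b c (Suc m) x)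
        = inverse D * D * moment_fps \<epsilon> a b c (Suc m) x" by (simp only: mult.assoc)
    then show ?case unfolding D by simp
  qed
  show ?case unfolding coeffs_tendsto_def
  proof (intro allI impI)
    fix k assume "k < K"
    with lim have "((\<lambda>x. fps_nth (inverse D * (fps_const (\<epsilon> / of_real x) * (B * moment_fps \<epsilon> a b c m x) + boundary_fps \<epsilon> a b c (Suc m) x)) k)
       \<longlongrightarrow> fps_nth (limit_fps \<epsilon> a b c (Suc m)) k) (at_left 1)"
      by (simp add: coeffs_tendsto_def)
    moreover from ev have "\<forall>\<^sub>F x in at_left (1::real). fps_nth (inverse D * (fps_const (\<epsilon> / of_real x) * (B * moment_fps \<epsilon> a b c m x) + boundary_fps \<epsilon> a b c (Suc m) x)) k
     = fps_nth (moment_fps \<epsilon> a b c (Suc m) x) k" by eventually_elim simp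
    ultimately show "((\<lambda>x. fps_nth (moment_fps \<epsilon> a b c (Suc m) x) k) \<longlongrightarrow> fps_nth (limit_fps \<epsilon> a b c (Suc m)) k) (at_left 1)"
      by (rule Lim_transform_eventually)
  qed
qed

text \<open>
  The coefficient of index \<open>K - 1\<close> of the damped series tends both to the Abel sum, which is the sum of the
  convergent series, and to the coefficient of the solved recurrence.
\<close>
theorem theorem2p4:
  fixes m K :: nat and \<epsilon> a b c :: complex
  assumes "K \<ge> 1"
    and "\<epsilon> \<in> {1, -1}"
    and "c \<notin> \<int>\<^sub>\<le>\<^sub>0"
    and "\<And>j. j \<in> {1..m} \<Longrightarrow> of_nat j + 1 - a \<noteq> 0 \<and> of_nat j + 1 - b \<noteq> 0"
    and "\<epsilon> = 1 \<Longrightarrow> Re (c - a - b) > -1"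
    and "\<epsilon> = -1 \<Longrightarrow> summable (A_term \<epsilon> m K a b c) \<and>
           (\<forall>k\<in>{1..K}. summable (A_term \<epsilon> 0 k a b c))"
  shows "A_sum \<epsilon> m K a b c =
    (\<Sum>s = 0..K - 1. (-1) ^ s * r_coeff \<epsilon> m a b c s * A_sum \<epsilon> 0 (K - s) a b c)
    + (-1) ^ (K - 1) * (\<Sum>j = 1..m. \<Sum>(u, v) | u + v = K - 1.
        t_coeff \<epsilon> m j a b c u * e_coeff \<epsilon> j a b c v)"
proof -
  note c = assms(3)
  have sm: "summable (A_term \<epsilon> m K a b c)" "\<And>k. k \<in> {1..K} \<Longrightarrow> summable (A_term \<epsilon> 0 k a b c)"
    using assms(1,2,5,6) A_term_summable_plus[OF c] by auto
  define k where "k = K - 1"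
  have K: "K = Suc k" using assms(1) by (simp add: k_def)
  have "coeffs_tendsto K (moment_fps \<epsilon> a b c m) (limit_fps \<epsilon> a b c m) (at_left 1)"
    using assms(4) by (intro moment_fps_tendsto c assms(2,5) sm) auto
  then have "((\<lambda>x. fps_nth (moment_fps \<epsilon> a b c m x) k) \<longlongrightarrow> fps_nth (limit_fps \<epsilon> a b c m) k) (at_left 1)"
    by (simp add: coeffs_tendsto_def K)
  moreover have "((\<lambda>x. fps_nth (moment_fps \<epsilon> a b c m x) k) \<longlongrightarrow> (-1) ^ k * A_sum \<epsilon> m K a b c) (at_left 1)"
    using moment_fps_nth_tendsto[of \<epsilon> m k a b c] sm(1) by (simp add: K)
  ultimately have eq: "(-1) ^ k * A_sum \<epsilon> m K a b c = fps_nth (limit_fps \<epsilon> a b c m) k"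
    by (intro tendsto_unique[of "at_left (1::real)"]) auto
  have sq: "(-1) ^ k * ((-1) ^ k * z) = z" for z :: complex
    by (simp add: mult.assoc[symmetric] flip: power_mult_distrib)
  have R: "(-1) ^ k * fps_nth (R_fps \<epsilon> m a b c * Abs_fps (\<lambda>k. (-1) ^ k * A_sum \<epsilon> 0 (Suc k) a b c)) k
      = (\<Sum>s = 0..k. (-1) ^ s * r_coeff \<epsilon> m a b c s * A_sum \<epsilon> 0 (K - s) a b c)"
    unfolding fps_mult_nth sum_distrib_left
  proof (intro sum.cong refl)
    fix s assume "s \<in> {0..k}"
    then have s: "s \<le> k" by simp
    then have "(-1) ^ k * (-1) ^ (k - s) = (-1 :: complex) ^ s"
      by (simp add: minus_one_power_iff)
    then have "(-1) ^ k * (z * ((-1) ^ (k - s) * y)) = (-1) ^ s * z * y" for z y :: complex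
      by (metis (no_types, opaque_lifting) mult.assoc mult.left_commute)
    moreover have "Suc (k - s) = K - s" using s by (simp add: K)
    ultimately show "(-1) ^ k * (fps_nth (R_fps \<epsilon> m a b c) s * fps_nth (Abs_fps (\<lambda>k. (-1) ^ k * A_sum \<epsilon> 0 (Suc k) a b c)) (k - s)) =
         (-1) ^ s * r_coeff \<epsilon> m a b c s * A_sum \<epsilon> 0 (K - s) a b c"
      by (simp only: R_fps_def r_coeff_def fps_nth_Abs_fps)
  qed
  have T: "fps_nth (T_fps \<epsilon> m j a b c * Abs_fps (e_coeff \<epsilon> j a b c)) k =
      (\<Sum>(u, v) | u + v = k. t_coeff \<epsilon> m j a b c u * e_coeff \<epsilon> j a b c v)" for j
    unfolding fps_mult_nth T_fps_def t_coeff_def fps_nth_Abs_fps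
    by (rule sum.reindex_bij_witness[of _ fst "\<lambda>u. (u, k - u)"]) auto
  have "A_sum \<epsilon> m K a b c = (-1) ^ k * fps_nth (limit_fps \<epsilon> a b c m) k"
    using eq sq by metis
  also have "\<dots> = (-1) ^ k * fps_nth (R_fps \<epsilon> m a b c * Abs_fps (\<lambda>k. (-1) ^ k * A_sum \<epsilon> 0 (Suc k) a b c)) k
     + (-1) ^ k * (\<Sum>j = 1..m. fps_nth (T_fps \<epsilon> m j a b c * Abs_fps (e_coeff \<epsilon> j a b c)) k)"
    by (simp only: limit_fps_def fps_add_nth fps_sum_nth distrib_left)
  finally show ?thesis unfolding R T k_def[symmetric] .
qed

end
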